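(* Let $A\in\mathcal{V}$ and let $g:B(Con(A))\rightarrow Clop(Max(A))$ be the map $g(\alpha)=Max(A)\cap D_A(\alpha)$. Then $Rad(A)$ has $CBLP$ if and only if $g$ is a Boolean isomorphism.
   Context: $\mathcal{V}$ is a congruence modular, semidegenerate variety (no nontrivial algebra has a one-element subalgebra) of finite signature. For $B\in\mathcal{V}$: $Con(B)$ is its congruence lattice with bounds $\Delta_B,\nabla_B$, $[\cdot,\cdot]$ the Freese–McKenzie commutator, $K(B)$ the compact congruences. A congruence $\phi\neq\nabla_B$ is prime if $[\alpha,\beta]\subseteq\phi$ implies $\alpha\subseteq\phi$ or $\beta\subseteq\phi$; $Spec(B)$ is the set of primes, $Max(B)$ the set of maximal congruences, $Rad(B)=\bigcap Max(B)$; $\rho(\theta)$ is the intersection of primes containing $\theta$. $D_B(\theta)=\{\phi\in Spec(B):\theta\not\subseteq\phi\}$; these are the open sets of the topology on $Spec(B)$, and $Max(B)$ has the subspace topology; $Clop(X)$ is the Boolean algebra of clopen subsets of $X$. $B(Con(B))$ is the Boolean algebra of complemented elements of $Con(B)$ (for $\alpha\in B(Con(A))$, $Max(A)\cap D_A(\alpha)$ is clopen in $Max(A)$ and $g$ is a Boolean morphism). When $K(B)$ is closed under the commutator, the reticulation $L(B)=K(B)/{\equiv}$ ($\alpha\equiv\beta$ iff $\rho(\alpha)=\rho(\beta)$) is a bounded distributive lattice with canonical map $\lambda_B$, mapping $B(Con(B))$ injectively into $B(L(B))$; the reticulation preserves the Boolean center if this map is onto $B(L(B))$. Standing assumption: for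 every $B\in\mathcal{V}$, $K(B)$ is closed under the commutator and the reticulation of $B$ preserves the Boolean center. A congruence $\theta$ of $A$ has $CBLP$ if for every $\beta\in B(Con(A/\theta))$ there is $\alpha\in B(Con(A))$ with $(\alpha\vee\theta)/\theta=\beta$. *)

theory Defs
  imports "HOL-Analysis.Analysis"
begin

type_synonym 'f sig = "'f set \<times> ('f \<Rightarrow> nat)"

definition syms :: "'f sig \<Rightarrow> 'f set" where "syms S = fst S"
definition arity :: "'f sig \<Rightarrow> 'f \<Rightarrow> nat" where "arity S = snd S"

record ('f, 'a) alg =
  ucarrier :: "'a set"
  uop :: "'f \<Rightarrow> 'a list \<Rightarrow> 'a"

definition algebra :: "'f sig \<Rightarrow> ('f, 'a) alg \<Rightarrow> bool" where
  "algebra S A \<longleftrightarrow> ucarrier A \<noteq> {} \<and>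
     (\<forall>f\<in>syms S. \<forall>xs. length xs = arity S f \<and> set xs \<subseteq> ucarrier A \<longrightarrow> uop A f xs \<in> ucarrier A)"

datatype 'f trm = Var nat | App 'f "'f trm list"

fun eval :: "('f, 'a) alg \<Rightarrow> (nat \<Rightarrow> 'a) \<Rightarrow> 'f trm \<Rightarrow> 'a" where
  "eval A v (Var i) = v i"
| "eval A v (App f ts) = uop A f (map (eval A v) ts)"

fun wf_trm :: "'f sig \<Rightarrow> 'f trm \<Rightarrow> bool" where
  "wf_trm S (Var i) = True"
| "wf_trm S (App f ts) = (f \<in> syms S \<and> length ts = arity S f \<and> list_all (wf_trm S) ts)"

fun vars :: "'f trm \<Rightarrow> nat set" where
  "vars (Var i) = {i}"
| "vars (App f ts) = \<Union> (set (map vars ts))"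

definition satisfies :: "('f, 'a) alg \<Rightarrow> 'f trm \<times> 'f trm \<Rightarrow> bool" where
  "satisfies A e \<longleftrightarrow> (\<forall>v. (\<forall>i. v i \<in> ucarrier A) \<longrightarrow> eval A v (fst e) = eval A v (snd e))"

definition inV :: "'f sig \<Rightarrow> ('f trm \<times> 'f trm) set \<Rightarrow> ('f, 'a) alg \<Rightarrow> bool" where
  "inV S Eqs A \<longleftrightarrow> algebra S A \<and> (\<forall>e\<in>Eqs. satisfies A e)"

definition is_cong :: "'f sig \<Rightarrow> ('f, 'a) alg \<Rightarrow> ('a \<times> 'a) set \<Rightarrow> bool" where
  "is_cong S A \<theta> \<longleftrightarrow> equiv (ucarrier A) \<theta> \<and>
     (\<forall>f\<in>syms S. \<forall>xs ys. length xs = arity S f \<and> length ys = arity S f \<and>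
        list_all2 (\<lambda>x y. (x, y) \<in> \<theta>) xs ys \<longrightarrow> (uop A f xs, uop A f ys) \<in> \<theta>)"

definition Con :: "'f sig \<Rightarrow> ('f, 'a) alg \<Rightarrow> ('a \<times> 'a) set set" where
  "Con S A = {\<theta>. is_cong S A \<theta>}"

definition Delta :: "('f, 'a) alg \<Rightarrow> ('a \<times> 'a) set" where
  "Delta A = Id_on (ucarrier A)"

definition Nabla :: "('f, 'a) alg \<Rightarrow> ('a \<times> 'a) set" where
  "Nabla A = ucarrier A \<times> ucarrier A"

definition Cg :: "'f sig \<Rightarrow> ('f, 'a) alg \<Rightarrow> ('a \<times> 'a) set \<Rightarrow> ('a \<times> 'a) set" where
  "Cg S A X = Nabla A \<inter> \<Inter> {\<theta> \<in> Con S A. X \<subseteq> \<theta>}"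

definition cjoin :: "'f sig \<Rightarrow> ('f, 'a) alg \<Rightarrow> ('a \<times> 'a) set \<Rightarrow> ('a \<times> 'a) set \<Rightarrow> ('a \<times> 'a) set" where
  "cjoin S A \<alpha> \<beta> = Cg S A (\<alpha> \<union> \<beta>)"

definition csup :: "'f sig \<Rightarrow> ('f, 'a) alg \<Rightarrow> ('a \<times> 'a) set set \<Rightarrow> ('a \<times> 'a) set" where
  "csup S A \<Theta> = Cg S A (\<Union> \<Theta>)"

definition K :: "'f sig \<Rightarrow> ('f, 'a) alg \<Rightarrow> ('a \<times> 'a) set set" where
  "K S A = {\<theta> \<in> Con S A. \<forall>\<Theta> \<subseteq> Con S A. \<theta> \<subseteq> csup S A \<Theta> \<longrightarrow>
              (\<exists>\<Theta>' \<subseteq> \<Theta>. finite \<Theta>' \<and> \<theta> \<subseteq> csup S A \<Theta>')}"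

section \<open>The commutator (term condition, as in Freese--McKenzie)\<close>

definition centralizes :: "'f sig \<Rightarrow> ('f, 'a) alg \<Rightarrow> ('a \<times> 'a) set \<Rightarrow> ('a \<times> 'a) set \<Rightarrow> ('a \<times> 'a) set \<Rightarrow> bool" where
  "centralizes S A \<alpha> \<beta> \<delta> \<longleftrightarrow>
     (\<forall>t a b c d. wf_trm S t \<and> vars t \<subseteq> {..<length a + length c} \<and>
        length b = length a \<and> length d = length c \<and>
        set a \<subseteq> ucarrier A \<and> set b \<subseteq> ucarrier A \<and> set c \<subseteq> ucarrier A \<and> set d \<subseteq> ucarrier A \<and>
        list_all2 (\<lambda>x y. (x, y) \<in> \<alpha>) a b \<and> list_all2 (\<lambda>x y. (x, y) \<in> \<beta>) c d \<and>
        (eval A (nth (a @ c)) t, eval A (nth (a @ d)) t) \<in> \<delta> \<longrightarrow>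
        (eval A (nth (b @ c)) t, eval A (nth (b @ d)) t) \<in> \<delta>)"

definition comm :: "'f sig \<Rightarrow> ('f, 'a) alg \<Rightarrow> ('a \<times> 'a) set \<Rightarrow> ('a \<times> 'a) set \<Rightarrow> ('a \<times> 'a) set" where
  "comm S A \<alpha> \<beta> = Nabla A \<inter> \<Inter> {\<delta> \<in> Con S A. centralizes S A \<alpha> \<beta> \<delta>}"

definition prime_cong :: "'f sig \<Rightarrow> ('f, 'a) alg \<Rightarrow> ('a \<times> 'a) set \<Rightarrow> bool" where
  "prime_cong S A \<phi> \<longleftrightarrow> \<phi> \<in> Con S A \<and> \<phi> \<noteq> Nabla A \<and>
     (\<forall>\<alpha>\<in>Con S A. \<forall>\<beta>\<in>Con S A. comm S A \<alpha> \<beta> \<subseteq> \<phi> \<longrightarrow> \<alpha> \<subseteq> \<phi> \<or> \<beta> \<subseteq> \<phi>)"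

definition Spec :: "'f sig \<Rightarrow> ('f, 'a) alg \<Rightarrow> ('a \<times> 'a) set set" where
  "Spec S A = {\<phi>. prime_cong S A \<phi>}"

definition Max :: "'f sig \<Rightarrow> ('f, 'a) alg \<Rightarrow> ('a \<times> 'a) set set" where
  "Max S A = {\<phi> \<in> Con S A. \<phi> \<noteq> Nabla A \<and>
                 (\<forall>\<psi>\<in>Con S A. \<phi> \<subseteq> \<psi> \<longrightarrow> \<psi> = \<phi> \<or> \<psi> = Nabla A)}"

(* intersection in Con(A); the empty intersection is Nabla *)
definition Rad :: "'f sig \<Rightarrow> ('f, 'a) alg \<Rightarrow> ('a \<times> 'a) set" where
  "Rad S A = Nabla A \<inter> \<Inter> (Max S A)"

definition rho :: "'f sig \<Rightarrow> ('f, 'a) alg \<Rightarrow> ('a \<times> 'a) set \<Rightarrow> ('a \<times> 'a) set" where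
  "rho S A \<theta> = Nabla A \<inter> \<Inter> {\<phi> \<in> Spec S A. \<theta> \<subseteq> \<phi>}"

definition D :: "'f sig \<Rightarrow> ('f, 'a) alg \<Rightarrow> ('a \<times> 'a) set \<Rightarrow> ('a \<times> 'a) set set" where
  "D S A \<theta> = {\<phi> \<in> Spec S A. \<not> \<theta> \<subseteq> \<phi>}"

definition spec_top :: "'f sig \<Rightarrow> ('f, 'a) alg \<Rightarrow> ('a \<times> 'a) set topology" where
  "spec_top S A = topology (\<lambda>U. \<exists>\<theta>\<in>Con S A. U = D S A \<theta>)"

definition max_top :: "'f sig \<Rightarrow> ('f, 'a) alg \<Rightarrow> ('a \<times> 'a) set topology" where
  "max_top S A = subtopology (spec_top S A) (Max S A)"

definition Clop :: "'b topology \<Rightarrow> 'b set set" where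
  "Clop T = {U. openin T U \<and> closedin T U}"

definition BoolCon :: "'f sig \<Rightarrow> ('f, 'a) alg \<Rightarrow> ('a \<times> 'a) set set" where
  "BoolCon S A = {\<alpha> \<in> Con S A. \<exists>\<beta>\<in>Con S A. cjoin S A \<alpha> \<beta> = Nabla A \<and> \<alpha> \<inter> \<beta> = Delta A}"

definition quot_alg :: "('f, 'a) alg \<Rightarrow> ('a \<times> 'a) set \<Rightarrow> ('f, 'a set) alg" where
  "quot_alg A \<theta> = \<lparr> ucarrier = ucarrier A // \<theta>,
       uop = (\<lambda>f Xs. \<theta> `` {uop A f (map (\<lambda>X. SOME x. x \<in> X) Xs)}) \<rparr>"

(* (alpha)/theta, a congruence of A/theta when theta \<subseteq> alpha *)
definition quot_cong :: "('a \<times> 'a) set \<Rightarrow> ('a \<times> 'a) set \<Rightarrow> ('a set \<times> 'a set) set" where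
  "quot_cong \<theta> \<alpha> = {(\<theta> `` {x}, \<theta> `` {y}) | x y. (x, y) \<in> \<alpha>}"

definition CBLP :: "'f sig \<Rightarrow> ('f, 'a) alg \<Rightarrow> ('a \<times> 'a) set \<Rightarrow> bool" where
  "CBLP S A \<theta> \<longleftrightarrow> (\<forall>\<beta>\<in>BoolCon S (quot_alg A \<theta>).
       \<exists>\<alpha>\<in>BoolCon S A. quot_cong \<theta> (cjoin S A \<alpha> \<theta>) = \<beta>)"

definition gmap :: "'f sig \<Rightarrow> ('f, 'a) alg \<Rightarrow> ('a \<times> 'a) set \<Rightarrow> ('a \<times> 'a) set set" where
  "gmap S A \<alpha> = Max S A \<inter> D S A \<alpha>"

definition bool_iso :: "'f sig \<Rightarrow> ('f, 'a) alg \<Rightarrow> (('a \<times> 'a) set \<Rightarrow> ('a \<times> 'a) set set) \<Rightarrow> bool" where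
  "bool_iso S A g \<longleftrightarrow> bij_betw g (BoolCon S A) (Clop (max_top S A)) \<and>
     g (Delta A) = {} \<and> g (Nabla A) = topspace (max_top S A) \<and>
     (\<forall>\<alpha>\<in>BoolCon S A. \<forall>\<beta>\<in>BoolCon S A.
        g (\<alpha> \<inter> \<beta>) = g \<alpha> \<inter> g \<beta> \<and> g (cjoin S A \<alpha> \<beta>) = g \<alpha> \<union> g \<beta>)"

definition ret_class :: "'f sig \<Rightarrow> ('f, 'a) alg \<Rightarrow> ('a \<times> 'a) set \<Rightarrow> ('a \<times> 'a) set set" where
  "ret_class S A \<alpha> = {\<beta> \<in> K S A. rho S A \<beta> = rho S A \<alpha>}"

definition RetL :: "'f sig \<Rightarrow> ('f, 'a) alg \<Rightarrow> ('a \<times> 'a) set set set" where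
  "RetL S A = ret_class S A ` K S A"

(* B(L(A)): complemented elements of L(A), where
   [a] \<or> [b] = [a \<or> b], [a] \<and> [b] = [[a,b]], 0 = [Delta], 1 = [Nabla] *)
definition RetBool :: "'f sig \<Rightarrow> ('f, 'a) alg \<Rightarrow> ('a \<times> 'a) set set set" where
  "RetBool S A = {x \<in> RetL S A. \<exists>y\<in>RetL S A. \<exists>\<alpha>\<in>x. \<exists>\<beta>\<in>y.
       ret_class S A (cjoin S A \<alpha> \<beta>) = ret_class S A (Nabla A) \<and>
       ret_class S A (comm S A \<alpha> \<beta>) = ret_class S A (Delta A)}"

definition K_comm_closed :: "'f sig \<Rightarrow> ('f, 'a) alg \<Rightarrow> bool" where
  "K_comm_closed S A \<longleftrightarrow> (\<forall>\<alpha>\<in>K S A. \<forall>\<beta>\<in>K S A. comm S A \<alpha> \<beta> \<in> K S A)"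

definition ret_preserves_bool :: "'f sig \<Rightarrow> ('f, 'a) alg \<Rightarrow> bool" where
  "ret_preserves_bool S A \<longleftrightarrow> RetBool S A \<subseteq> ret_class S A ` BoolCon S A"

section \<open>Properties of the variety (restricted to members carried by the type 'a)\<close>

definition modular_Con :: "'f sig \<Rightarrow> ('f, 'a) alg \<Rightarrow> bool" where
  "modular_Con S A \<longleftrightarrow> (\<forall>\<alpha>\<in>Con S A. \<forall>\<beta>\<in>Con S A. \<forall>\<gamma>\<in>Con S A.
      \<alpha> \<subseteq> \<gamma> \<longrightarrow> cjoin S A \<alpha> (\<beta> \<inter> \<gamma>) = cjoin S A \<alpha> \<beta> \<inter> \<gamma>)"

definition has_one_elem_subalg :: "'f sig \<Rightarrow> ('f, 'a) alg \<Rightarrow> bool" where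
  "has_one_elem_subalg S A \<longleftrightarrow>
     (\<exists>x\<in>ucarrier A. \<forall>f\<in>syms S. uop A f (replicate (arity S f) x) = x)"

definition nontrivial_alg :: "('f, 'a) alg \<Rightarrow> bool" where
  "nontrivial_alg A \<longleftrightarrow> (\<exists>x\<in>ucarrier A. \<exists>y\<in>ucarrier A. x \<noteq> y)"

end

theory Submission
  imports Defs
begin

text \<open>
  Three facts about \<open>Con A\<close> carry the proof: every proper congruence lies below a maximal one,
  maximal congruences are prime, and \<open>\<alpha> \<or> \<gamma> = \<nabla>\<close>, \<open>\<alpha> \<inter> \<beta> \<subseteq> \<delta>\<close>, \<open>\<gamma> \<subseteq> \<delta>\<close> imply \<open>\<beta> \<subseteq> \<delta>\<close>.
  A congruence one of whose classes is a subalgebra is \<open>\<nabla>\<close>, by semidegeneracy; as the signature is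
  finite, \<open>\<nabla>\<close> is finitely generated, which gives the first fact.  Applied to \<open>\<beta>\<close> as a
  subalgebra of \<open>A \<times> A\<close>, the same principle shows that \<open>\<beta> \<subseteq> \<delta>\<close> whenever \<open>\<alpha>\<close> and \<open>\<gamma>\<close> both centralize
  \<open>\<beta>\<close> modulo \<open>\<delta>\<close> and \<open>\<alpha> \<or> \<gamma> = \<nabla>\<close>.  By modularity, in the form of Gumm's shifting lemma,
  \<open>\<alpha>\<close> centralizes \<open>\<beta>\<close> modulo every \<open>\<delta> \<supseteq> \<alpha> \<inter> \<beta>\<close>, and even modulo every \<open>\<delta> \<supseteq> [\<alpha>, \<beta>]\<close>; this gives the
  other two.  Complemented congruences of \<open>A / Rad A\<close> are then the same as clopen subsets of \<open>Max A\<close>,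
  and \<open>g\<close> is always injective.
\<close>

section \<open>Congruences\<close>

lemma ConD:
  assumes "\<theta> \<in> Con S A"
  shows Con_equiv: "equiv (ucarrier A) \<theta>"
    and Con_subset: "\<theta> \<subseteq> ucarrier A \<times> ucarrier A"
    and Con_refl: "\<And>x. x \<in> ucarrier A \<Longrightarrow> (x, x) \<in> \<theta>"
    and Con_sym: "\<And>x y. (x, y) \<in> \<theta> \<Longrightarrow> (y, x) \<in> \<theta>"
    and Con_trans: "\<And>x y z. (x, y) \<in> \<theta> \<Longrightarrow> (y, z) \<in> \<theta> \<Longrightarrow> (x, z) \<in> \<theta>"
    and Con_op: "\<And>f xs ys. f \<in> syms S \<Longrightarrow> length xs = arity S f \<Longrightarrow>
      list_all2 (\<lambda>x y. (x, y) \<in> \<theta>) xs ys \<Longrightarrow> (uop A f xs, uop A f ys) \<in> \<theta>"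
proof -
  show e: "equiv (ucarrier A) \<theta>" using assms by (simp add: Con_def is_cong_def)
  show "\<theta> \<subseteq> ucarrier A \<times> ucarrier A" using e by (rule equiv_type)
  show "\<And>x. x \<in> ucarrier A \<Longrightarrow> (x, x) \<in> \<theta>" using e by (auto simp: equiv_def refl_on_def)
  show "\<And>x y. (x, y) \<in> \<theta> \<Longrightarrow> (y, x) \<in> \<theta>" using e by (auto simp: equiv_def sym_def)
  show "\<And>x y z. (x, y) \<in> \<theta> \<Longrightarrow> (y, z) \<in> \<theta> \<Longrightarrow> (x, z) \<in> \<theta>"
    using e by (auto simp: equiv_def trans_def)
  fix f xs ys
  assume f: "f \<in> syms S" "length xs = arity S f" and l: "list_all2 (\<lambda>x y. (x, y) \<in> \<theta>) xs ys"
  have "length ys = arity S f" using list_all2_lengthD[OF l] f by simp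
  then show "(uop A f xs, uop A f ys) \<in> \<theta>"
    using assms f l unfolding Con_def is_cong_def mem_Collect_eq by blast
qed

lemma algebra_op:
  "algebra S A \<Longrightarrow> f \<in> syms S \<Longrightarrow> length xs = arity S f \<Longrightarrow> set xs \<subseteq> ucarrier A \<Longrightarrow>
    uop A f xs \<in> ucarrier A"
  by (simp add: algebra_def)

lemma ConI:
  assumes "\<theta> \<subseteq> ucarrier A \<times> ucarrier A"
    and "\<And>x. x \<in> ucarrier A \<Longrightarrow> (x, x) \<in> \<theta>"
    and "\<And>x y. (x, y) \<in> \<theta> \<Longrightarrow> (y, x) \<in> \<theta>"
    and "\<And>x y z. (x, y) \<in> \<theta> \<Longrightarrow> (y, z) \<in> \<theta> \<Longrightarrow> (x, z) \<in> \<theta>"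
    and "\<And>f xs ys. f \<in> syms S \<Longrightarrow> length xs = arity S f \<Longrightarrow> length ys = arity S f \<Longrightarrow>
      list_all2 (\<lambda>x y. (x, y) \<in> \<theta>) xs ys \<Longrightarrow> (uop A f xs, uop A f ys) \<in> \<theta>"
  shows "\<theta> \<in> Con S A"
  unfolding Con_def is_cong_def mem_Collect_eq
proof (intro conjI ballI allI impI)
  show "equiv (ucarrier A) \<theta>"
    using assms(1-2) by (intro equivI refl_onI symI transI) (blast intro: assms(3,4))+
qed (use assms(5) in blast)

text \<open>Replacing the arguments one at a time, from left to right, and chaining by transitivity
  reduces compatibility with an operation to compatibility in each single argument.\<close>

lemma ConI_translations:
  assumes A: "algebra S A"
    and sub: "\<theta> \<subseteq> ucarrier A \<times> ucarrier A"
    and refl: "\<And>x. x \<in> ucarrier A \<Longrightarrow> (x, x) \<in> \<theta>"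
    and sym: "\<And>x y. (x, y) \<in> \<theta> \<Longrightarrow> (y, x) \<in> \<theta>"
    and trans: "\<And>x y z. (x, y) \<in> \<theta> \<Longrightarrow> (y, z) \<in> \<theta> \<Longrightarrow> (x, z) \<in> \<theta>"
    and tr: "\<And>f us x y vs. f \<in> syms S \<Longrightarrow> length (us @ x # vs) = arity S f \<Longrightarrow>
      set us \<subseteq> ucarrier A \<Longrightarrow> set vs \<subseteq> ucarrier A \<Longrightarrow> (x, y) \<in> \<theta> \<Longrightarrow>
      (uop A f (us @ x # vs), uop A f (us @ y # vs)) \<in> \<theta>"
  shows "\<theta> \<in> Con S A"
proof (rule ConI[OF sub refl sym trans])
  fix f xs ys
  assume f: "f \<in> syms S" and len: "length xs = arity S f"
    and l: "list_all2 (\<lambda>x y. (x, y) \<in> \<theta>) xs ys"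
  \<comment> \<open>The prefix \<open>us\<close> holds the arguments already replaced, so it has to
    be arbitrary in the induction.\<close>
  have "(uop A f (us @ xs), uop A f (us @ ys)) \<in> \<theta>"
    if "set us \<subseteq> ucarrier A" "length (us @ xs) = arity S f" for us
    using l that
  proof (induction arbitrary: us rule: list_all2_induct)
    case Nil
    then show ?case using A f by (auto intro!: refl algebra_op)
  next
    case (Cons x xs y ys)
    have xy: "x \<in> ucarrier A" "y \<in> ucarrier A" using sub Cons(1) by auto
    have "list_all2 (\<lambda>x y. (x, y) \<in> \<theta>) xs ys" using Cons by simp
    then have "set xs \<subseteq> ucarrier A"
      using sub by (induction rule: list_all2_induct) auto
    then have "(uop A f (us @ x # xs), uop A f (us @ y # xs)) \<in> \<theta>"
      using Cons f by (intro tr) auto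
    moreover have "(uop A f ((us @ [y]) @ xs), uop A f ((us @ [y]) @ ys)) \<in> \<theta>"
      using Cons xy by (intro Cons(3)) auto
    ultimately show ?case by (auto intro: trans)
  qed
  from this[of "[]"] len show "(uop A f xs, uop A f ys) \<in> \<theta>" by simp
qed auto

lemma list_all2_reflI_on: "set xs \<subseteq> X \<Longrightarrow> (\<And>x. x \<in> X \<Longrightarrow> P x x) \<Longrightarrow> list_all2 P xs xs"
  by (induction xs) auto

lemma list_all2_subset:
  assumes "list_all2 (\<lambda>x y. (x, y) \<in> r) xs ys" and "r \<subseteq> X \<times> Y"
  shows "set xs \<subseteq> X" "set ys \<subseteq> Y"
  using assms by (induction rule: list_all2_induct) auto

lemma Con_translation:
  assumes "\<theta> \<in> Con S A" "f \<in> syms S" "length (us @ x # vs) = arity S f"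
    "set us \<subseteq> ucarrier A" "set vs \<subseteq> ucarrier A" "(x, y) \<in> \<theta>"
  shows "(uop A f (us @ x # vs), uop A f (us @ y # vs)) \<in> \<theta>"
proof (rule Con_op[OF assms(1-3)])
  show "list_all2 (\<lambda>x y. (x, y) \<in> \<theta>) (us @ x # vs) (us @ y # vs)"
    using assms by (intro list_all2_appendI list_all2_Cons[THEN iffD2] conjI)
      (auto intro: list_all2_reflI_on[where X = "ucarrier A"] Con_refl[OF assms(1)])
qed

text \<open>A translation maps a chain of \<open>R\<close>-steps to a chain of
  \<open>R\<close>-steps, so the transitive closure inherits compatibility in each argument, which
  suffices by \<open>ConI_translations\<close>.\<close>

lemma trancl_in_Con:
  assumes A: "algebra S A" and sub: "R \<subseteq> ucarrier A \<times> ucarrier A"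
    and refl: "\<And>x. x \<in> ucarrier A \<Longrightarrow> (x, x) \<in> R" and "sym R"
    and tr: "\<And>f us x y vs. f \<in> syms S \<Longrightarrow> length (us @ x # vs) = arity S f \<Longrightarrow>
      set us \<subseteq> ucarrier A \<Longrightarrow> set vs \<subseteq> ucarrier A \<Longrightarrow> (x, y) \<in> R \<Longrightarrow>
      (uop A f (us @ x # vs), uop A f (us @ y # vs)) \<in> R"
  shows "R\<^sup>+ \<in> Con S A"
proof (rule ConI_translations[OF A])
  show "R\<^sup>+ \<subseteq> ucarrier A \<times> ucarrier A" using sub by (rule trancl_subset_Sigma)
  show "\<And>x y. (x, y) \<in> R\<^sup>+ \<Longrightarrow> (y, x) \<in> R\<^sup>+"
    using sym_trancl[OF \<open>sym R\<close>] by (auto dest: symD)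
  fix f us x y vs
  assume *: "f \<in> syms S" "length (us @ x # vs) = arity S f"
    "set us \<subseteq> ucarrier A" "set vs \<subseteq> ucarrier A"
  assume "(x, y) \<in> R\<^sup>+"
  then show "(uop A f (us @ x # vs), uop A f (us @ y # vs)) \<in> R\<^sup>+"
  proof induction
    case (base y)
    then show ?case using * by (intro r_into_trancl tr) auto
  next
    case (step y z)
    have "(uop A f (us @ y # vs), uop A f (us @ z # vs)) \<in> R" using * step by (intro tr) auto
    with step.IH show ?case by (rule trancl_into_trancl)
  qed
qed (auto intro: refl)

lemma Nabla_in_Con: "algebra S A \<Longrightarrow> Nabla A \<in> Con S A"
  unfolding Nabla_def by (intro ConI_translations) (auto intro!: algebra_op)

lemma Delta_in_Con: "algebra S A \<Longrightarrow> Delta A \<in> Con S A"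
  unfolding Delta_def by (intro ConI_translations) (auto intro!: algebra_op)

lemma Con_Inter:
  assumes A: "algebra S A" and "\<Theta> \<subseteq> Con S A"
  shows "Nabla A \<inter> \<Inter> \<Theta> \<in> Con S A"
proof (rule ConI_translations[OF A])
  fix f us x y vs
  assume *: "f \<in> syms S" "length (us @ x # vs) = arity S f"
    "set us \<subseteq> ucarrier A" "set vs \<subseteq> ucarrier A"
  assume xy: "(x, y) \<in> Nabla A \<inter> \<Inter> \<Theta>"
  have "(uop A f (us @ x # vs), uop A f (us @ y # vs)) \<in> \<theta>" if "\<theta> \<in> insert (Nabla A) \<Theta>" for \<theta>
    using that * xy assms Nabla_in_Con[OF A] by (intro Con_translation) auto
  then show "(uop A f (us @ x # vs), uop A f (us @ y # vs)) \<in> Nabla A \<inter> \<Inter> \<Theta>" by auto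
qed (use assms(2) in \<open>auto simp: Nabla_def intro: Con_refl Con_sym Con_trans\<close>)

lemma Con_Int:
  assumes "algebra S A" "\<alpha> \<in> Con S A" "\<beta> \<in> Con S A"
  shows "\<alpha> \<inter> \<beta> \<in> Con S A"
proof -
  have "Nabla A \<inter> \<Inter> {\<alpha>, \<beta>} = \<alpha> \<inter> \<beta>" using Con_subset[OF assms(2)] by (auto simp: Nabla_def)
  then show ?thesis using Con_Inter[of S A "{\<alpha>, \<beta>}"] assms by simp
qed

lemma Cg_in_Con: "algebra S A \<Longrightarrow> Cg S A X \<in> Con S A"
  unfolding Cg_def by (rule Con_Inter) auto

lemma Cg_upper: "X \<subseteq> Nabla A \<Longrightarrow> X \<subseteq> Cg S A X"
  unfolding Cg_def by auto

lemma Cg_least: "\<theta> \<in> Con S A \<Longrightarrow> X \<subseteq> \<theta> \<Longrightarrow> Cg S A X \<subseteq> \<theta>"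
  unfolding Cg_def by auto

lemma Con_le_Nabla: "\<theta> \<in> Con S A \<Longrightarrow> \<theta> \<subseteq> Nabla A"
  using Con_subset by (simp add: Nabla_def)

lemma Delta_le_Con: "\<theta> \<in> Con S A \<Longrightarrow> Delta A \<subseteq> \<theta>"
  by (auto simp: Delta_def intro: Con_refl)

lemma cjoin_in_Con: "algebra S A \<Longrightarrow> cjoin S A \<alpha> \<beta> \<in> Con S A"
  unfolding cjoin_def by (rule Cg_in_Con)

lemma cjoin_upper:
  assumes "\<alpha> \<in> Con S A" "\<beta> \<in> Con S A"
  shows "\<alpha> \<subseteq> cjoin S A \<alpha> \<beta>" "\<beta> \<subseteq> cjoin S A \<alpha> \<beta>"
  using Cg_upper[of "\<alpha> \<union> \<beta>" A S] assms[THEN Con_le_Nabla] unfolding cjoin_def by auto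

lemma cjoin_least: "\<theta> \<in> Con S A \<Longrightarrow> \<alpha> \<subseteq> \<theta> \<Longrightarrow> \<beta> \<subseteq> \<theta> \<Longrightarrow> cjoin S A \<alpha> \<beta> \<subseteq> \<theta>"
  unfolding cjoin_def by (rule Cg_least) auto

lemma cjoin_le_iff:
  assumes "\<alpha> \<in> Con S A" "\<beta> \<in> Con S A" "\<theta> \<in> Con S A"
  shows "cjoin S A \<alpha> \<beta> \<subseteq> \<theta> \<longleftrightarrow> \<alpha> \<subseteq> \<theta> \<and> \<beta> \<subseteq> \<theta>"
  using cjoin_upper[OF assms(1,2)] cjoin_least[OF assms(3)] by blast

lemma cjoin_eq_NablaI:
  assumes "algebra S A"
    and "\<And>\<theta>. \<theta> \<in> Con S A \<Longrightarrow> \<alpha> \<subseteq> \<theta> \<Longrightarrow> \<beta> \<subseteq> \<theta> \<Longrightarrow> \<theta> = Nabla A"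
    and "\<alpha> \<in> Con S A" "\<beta> \<in> Con S A"
  shows "cjoin S A \<alpha> \<beta> = Nabla A"
  using assms(2)[OF cjoin_in_Con[OF assms(1)] cjoin_upper[OF assms(3,4)]] .

section \<open>Surjective homomorphisms and quotients\<close>

text \<open>One notion serves for quotient maps, for the two projections of a congruence onto
  \<open>A\<close>, and for relabelling a carrier along an injection.\<close>

definition surj_hom :: "'f sig \<Rightarrow> ('f, 'a) alg \<Rightarrow> ('f, 'b) alg \<Rightarrow> ('a \<Rightarrow> 'b) \<Rightarrow> bool" where
  "surj_hom S A B h \<longleftrightarrow> h ` ucarrier A = ucarrier B \<and>
     (\<forall>f\<in>syms S. \<forall>xs. length xs = arity S f \<and> set xs \<subseteq> ucarrier A \<longrightarrow>
        h (uop A f xs) = uop B f (map h xs))"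

lemma lift_list:
  assumes "set ys \<subseteq> h ` X"
  obtains xs where "set xs \<subseteq> X" "ys = map h xs"
proof -
  have "\<exists>xs. set xs \<subseteq> X \<and> ys = map h xs"
    using assms
  proof (induction ys)
    case (Cons y ys)
    then obtain xs x where "set xs \<subseteq> X" "ys = map h xs" "x \<in> X" "y = h x" by auto
    then show ?case by (intro exI[of _ "x # xs"]) auto
  qed auto
  then show ?thesis using that by auto
qed

lemma surj_hom_algebra:
  assumes h: "surj_hom S A B h" and A: "algebra S A"
  shows "algebra S B"
  unfolding algebra_def
proof (intro conjI ballI allI impI)
  show "ucarrier B \<noteq> {}" using h A unfolding surj_hom_def algebra_def by auto
  fix f ys
  assume f: "f \<in> syms S" and ys: "length ys = arity S f \<and> set ys \<subseteq> ucarrier B"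
  then obtain xs where "set xs \<subseteq> ucarrier A" "ys = map h xs"
    using h lift_list[of ys h "ucarrier A"] unfolding surj_hom_def by metis
  moreover from this have "uop A f xs \<in> ucarrier A" using A f ys by (auto intro: algebra_op)
  moreover from calculation have "uop B f ys = h (uop A f xs)"
    using h f ys unfolding surj_hom_def by simp
  ultimately show "uop B f ys \<in> ucarrier B" using h unfolding surj_hom_def by blast
qed

lemma eval_in_carrier:
  assumes "algebra S A" "\<And>i. v i \<in> ucarrier A" "wf_trm S t"
  shows "eval A v t \<in> ucarrier A"
  using assms(3)
proof (induction t)
  case (App f ts)
  then show ?case using assms(1) by (auto simp: list_all_iff intro!: algebra_op)
qed (simp add: assms)

lemma surj_hom_eval:
  assumes h: "surj_hom S A B h" and A: "algebra S A" and v: "\<And>i. v i \<in> ucarrier A"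
    and "wf_trm S t"
  shows "eval B (\<lambda>i. h (v i)) t = h (eval A v t)"
  using assms(4)
proof (induction t)
  case (App f ts)
  have IH: "map (eval B (\<lambda>i. h (v i))) ts = map h (map (eval A v) ts)"
    using App by (auto simp: list_all_iff)
  have sub: "set (map (eval A v) ts) \<subseteq> ucarrier A"
    using App.prems A v by (auto simp: list_all_iff intro: eval_in_carrier)
  have "h (uop A f (map (eval A v) ts)) = uop B f (map h (map (eval A v) ts))"
    using h App.prems sub unfolding surj_hom_def by (metis length_map wf_trm.simps(2))
  then show ?case using IH by (simp del: map_map)
qed simp

text \<open>A valuation in \<open>B\<close> lifts through the surjection to a valuation in
  \<open>A\<close>, where the identities hold. Well-formedness enters because \<open>h\<close>
  respects only the operations of the signature at their arity.\<close>

lemma surj_hom_inV: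
  assumes h: "surj_hom S A B h" and A: "inV S Eqs A"
    and wf: "\<forall>e\<in>Eqs. wf_trm S (fst e) \<and> wf_trm S (snd e)"
  shows "inV S Eqs B"
  unfolding inV_def satisfies_def
proof (intro conjI ballI allI impI)
  have alg: "algebra S A" using A by (simp add: inV_def)
  show "algebra S B" using h alg by (rule surj_hom_algebra)
  fix e and w :: "nat \<Rightarrow> 'c"
  assume e: "e \<in> Eqs" and "\<forall>i. w i \<in> ucarrier B"
  then have "\<forall>i. \<exists>x\<in>ucarrier A. w i = h x" using h unfolding surj_hom_def by blast
  then obtain v where v: "\<And>i. v i \<in> ucarrier A" "\<And>i. w i = h (v i)" by metis
  then have "w = (\<lambda>i. h (v i))" by auto
  moreover have "eval A v (fst e) = eval A v (snd e)"
    using A e v unfolding inV_def satisfies_def by blast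
  ultimately show "eval B w (fst e) = eval B w (snd e)"
    using surj_hom_eval[where v = v, OF h alg v(1)] wf e by simp
qed

lemma surj_hom_vimage:
  assumes h: "surj_hom S A B h" and A: "algebra S A" and \<beta>: "\<beta> \<in> Con S B"
  shows "{(x, y) \<in> ucarrier A \<times> ucarrier A. (h x, h y) \<in> \<beta>} \<in> Con S A"
    (is "?\<gamma> \<in> _")
proof (rule ConI)
  have hc: "x \<in> ucarrier A \<Longrightarrow> h x \<in> ucarrier B" for x using h unfolding surj_hom_def by blast
  then show "\<And>x. x \<in> ucarrier A \<Longrightarrow> (x, x) \<in> ?\<gamma>" using Con_refl[OF \<beta>] by auto
  show "\<And>x y. (x, y) \<in> ?\<gamma> \<Longrightarrow> (y, x) \<in> ?\<gamma>" using Con_sym[OF \<beta>] by auto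
  show "\<And>x y z. (x, y) \<in> ?\<gamma> \<Longrightarrow> (y, z) \<in> ?\<gamma> \<Longrightarrow> (x, z) \<in> ?\<gamma>" using Con_trans[OF \<beta>] by blast
  fix f xs ys
  assume f: "f \<in> syms S" "length xs = arity S f" "length ys = arity S f"
    and l: "list_all2 (\<lambda>x y. (x, y) \<in> ?\<gamma>) xs ys"
  have c: "set xs \<subseteq> ucarrier A" "set ys \<subseteq> ucarrier A"
    using list_all2_subset[OF l, of "ucarrier A" "ucarrier A"] by auto
  have "list_all2 (\<lambda>x y. (x, y) \<in> \<beta>) (map h xs) (map h ys)"
    using l by (auto simp: list_all2_map1 list_all2_map2 elim: list_all2_mono)
  then have "(uop B f (map h xs), uop B f (map h ys)) \<in> \<beta>"
    using f by (intro Con_op[OF \<beta>]) auto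
  then show "(uop A f xs, uop A f ys) \<in> ?\<gamma>"
    using h f c algebra_op[OF A f(1)] unfolding surj_hom_def by auto
qed auto

lemma surj_hom_image:
  assumes h: "surj_hom S A B h" and A: "algebra S A" and \<gamma>: "\<gamma> \<in> Con S A"
    and ker: "\<And>x y. x \<in> ucarrier A \<Longrightarrow> y \<in> ucarrier A \<Longrightarrow> h x = h y \<Longrightarrow> (x, y) \<in> \<gamma>"
  shows "map_prod h h ` \<gamma> \<in> Con S B"
    and "\<And>x y. x \<in> ucarrier A \<Longrightarrow> y \<in> ucarrier A \<Longrightarrow>
      (h x, h y) \<in> map_prod h h ` \<gamma> \<longleftrightarrow> (x, y) \<in> \<gamma>"
proof -
  note sub = Con_subset[OF \<gamma>]
  have img: "h ` ucarrier A = ucarrier B" using h by (simp add: surj_hom_def)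
  show *: "(h x, h y) \<in> map_prod h h ` \<gamma> \<longleftrightarrow> (x, y) \<in> \<gamma>"
    if xy: "x \<in> ucarrier A" "y \<in> ucarrier A" for x y
  proof
    assume "(h x, h y) \<in> map_prod h h ` \<gamma>"
    then obtain x' y' where x'y': "h x = h x'" "h y = h y'" "(x', y') \<in> \<gamma>" by auto
    then have "(x, x') \<in> \<gamma>" "(y', y) \<in> \<gamma>" using sub xy by (auto intro!: ker)
    then show "(x, y) \<in> \<gamma>" using x'y' Con_trans[OF \<gamma>] by blast
  qed force
  have sub': "map_prod h h ` \<gamma> \<subseteq> ucarrier B \<times> ucarrier B" using sub img by auto
  show "map_prod h h ` \<gamma> \<in> Con S B"
  proof (rule ConI_translations[OF surj_hom_algebra[OF h A] sub'])
    fix x assume "x \<in> ucarrier B"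
    then show "(x, x) \<in> map_prod h h ` \<gamma>" using img Con_refl[OF \<gamma>] by force
  next
    fix x y assume "(x, y) \<in> map_prod h h ` \<gamma>"
    then show "(y, x) \<in> map_prod h h ` \<gamma>" using Con_sym[OF \<gamma>] by force
  next
    fix x y z assume "(x, y) \<in> map_prod h h ` \<gamma>" "(y, z) \<in> map_prod h h ` \<gamma>"
    then obtain x' y' y'' z' where xyz: "(x', y') \<in> \<gamma>" "(y'', z') \<in> \<gamma>"
      "x = h x'" "y = h y'" "y = h y''" "z = h z'" by auto
    \<comment> \<open>The middle element comes with two preimages; they are linked because the
      kernel of \<open>h\<close> lies in \<gamma>.\<close>
    then have "(y', y'') \<in> \<gamma>" using sub by (intro ker) auto
    then have "(x', z') \<in> \<gamma>" using xyz Con_trans[OF \<gamma>] by blast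
    then show "(x, z) \<in> map_prod h h ` \<gamma>" using xyz by force
  next
    fix f us x y vs
    assume f: "f \<in> syms S" and len: "length (us @ x # vs) = arity S f"
      and uv: "set us \<subseteq> ucarrier B" "set vs \<subseteq> ucarrier B"
      and xy: "(x, y) \<in> map_prod h h ` \<gamma>"
    obtain us' where u: "set us' \<subseteq> ucarrier A" "us = map h us'"
      by (rule lift_list[of us h "ucarrier A"]) (use uv img in auto)
    obtain vs' where v: "set vs' \<subseteq> ucarrier A" "vs = map h vs'"
      by (rule lift_list[of vs h "ucarrier A"]) (use uv img in auto)
    obtain x' y' where x: "x = h x'" "y = h y'" "(x', y') \<in> \<gamma>" using xy by auto
    have xc: "x' \<in> ucarrier A" "y' \<in> ucarrier A" using x sub by auto
    have "(uop A f (us' @ x' # vs'), uop A f (us' @ y' # vs')) \<in> \<gamma>"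
      using f len u v x by (intro Con_translation[OF \<gamma>]) auto
    moreover have "h (uop A f (us' @ z # vs')) = uop B f (us @ h z # vs)"
      if "z \<in> ucarrier A" for z
      using h f len u v that unfolding surj_hom_def by simp
    ultimately show "(uop B f (us @ x # vs), uop B f (us @ y # vs)) \<in> map_prod h h ` \<gamma>"
      using x xc by (metis map_prod_imageI)
  qed
qed

text \<open>The operations are independent of the chosen preimages only if the kernel of \<open>h\<close> is a congruence.\<close>

definition image_alg :: "('f, 'a) alg \<Rightarrow> ('a \<Rightarrow> 'b) \<Rightarrow> ('f, 'b) alg" where
  "image_alg A h = \<lparr> ucarrier = h ` ucarrier A,
     uop = (\<lambda>f xs. h (uop A f (map (inv_into (ucarrier A) h) xs))) \<rparr>"

text \<open>An element and the preimage that \<open>inv_into\<close> picks for its image form a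
  kernel pair, and the kernel is compatible with the operations.\<close>

lemma surj_hom_image_alg:
  assumes ker: "{(x, y) \<in> ucarrier A \<times> ucarrier A. h x = h y} \<in> Con S A"
  shows "surj_hom S A (image_alg A h) h"
  unfolding surj_hom_def
proof (intro conjI ballI allI impI)
  show "h ` ucarrier A = ucarrier (image_alg A h)" by (simp add: image_alg_def)
  fix f xs
  assume f: "f \<in> syms S" and xs: "length xs = arity S f \<and> set xs \<subseteq> ucarrier A"
  have "list_all2 (\<lambda>x y. (x, y) \<in> {(x, y) \<in> ucarrier A \<times> ucarrier A. h x = h y})
    xs (map (inv_into (ucarrier A) h) (map h xs))"
    using xs by (auto simp: list_all2_conv_all_nth subset_iff f_inv_into_f inv_into_into)
  then have "(uop A f xs, uop A f (map (inv_into (ucarrier A) h) (map h xs))) \<in>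
    {(x, y) \<in> ucarrier A \<times> ucarrier A. h x = h y}"
    using f xs by (intro Con_op[OF ker]) auto
  then show "h (uop A f xs) = uop (image_alg A h) f (map h xs)"
    by (simp add: image_alg_def)
qed

lemma surj_hom_quot_alg:
  assumes \<theta>: "\<theta> \<in> Con S A"
  shows "surj_hom S A (quot_alg A \<theta>) (\<lambda>x. \<theta> `` {x})"
  unfolding surj_hom_def
proof (intro conjI ballI allI impI)
  show "(\<lambda>x. \<theta> `` {x}) ` ucarrier A = ucarrier (quot_alg A \<theta>)"
    by (auto simp: quot_alg_def quotient_def)
  fix f xs
  assume f: "f \<in> syms S" and xs: "length xs = arity S f \<and> set xs \<subseteq> ucarrier A"
  have "(x, SOME y. y \<in> \<theta> `` {x}) \<in> \<theta>" if "x \<in> ucarrier A" for x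
    using someI[of "\<lambda>y. y \<in> \<theta> `` {x}" x] Con_refl[OF \<theta> that] by auto
  then have "list_all2 (\<lambda>x y. (x, y) \<in> \<theta>)
      xs (map (\<lambda>X. SOME y. y \<in> X) (map (\<lambda>x. \<theta> `` {x}) xs))"
    using xs by (auto simp: list_all2_conv_all_nth subset_iff)
  then have "(uop A f xs, uop A f (map (\<lambda>X. SOME y. y \<in> X) (map (\<lambda>x. \<theta> `` {x}) xs))) \<in> \<theta>"
    using f xs by (intro Con_op[OF \<theta>]) auto
  then show "\<theta> `` {uop A f xs} = uop (quot_alg A \<theta>) f (map (\<lambda>x. \<theta> `` {x}) xs)"
    using equiv_class_eq[OF Con_equiv[OF \<theta>]] by (simp add: quot_alg_def)
qed

section \<open>The correspondence theorem and complemented congruences of a quotient\<close>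

lemma quot_cong_eq_image: "quot_cong \<theta> \<alpha> = map_prod (\<lambda>x. \<theta> `` {x}) (\<lambda>x. \<theta> `` {x}) ` \<alpha>"
  by (force simp: quot_cong_def)

lemma quot_cong_in_Con:
  assumes A: "algebra S A" and \<theta>: "\<theta> \<in> Con S A" and \<gamma>: "\<gamma> \<in> Con S A" and le: "\<theta> \<subseteq> \<gamma>"
  shows "quot_cong \<theta> \<gamma> \<in> Con S (quot_alg A \<theta>)"
    and "\<And>x y. x \<in> ucarrier A \<Longrightarrow> y \<in> ucarrier A \<Longrightarrow>
      (\<theta> `` {x}, \<theta> `` {y}) \<in> quot_cong \<theta> \<gamma> \<longleftrightarrow> (x, y) \<in> \<gamma>"
proof -
  have "(x, y) \<in> \<gamma>" if "x \<in> ucarrier A" "y \<in> ucarrier A" "\<theta> `` {x} = \<theta> `` {y}" for x y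
    using that le eq_equiv_class_iff[OF Con_equiv[OF \<theta>]] by blast
  note img = surj_hom_image[OF surj_hom_quot_alg[OF \<theta>] A \<gamma> this, folded quot_cong_eq_image]
  show "quot_cong \<theta> \<gamma> \<in> Con S (quot_alg A \<theta>)" by (rule img(1))
  show "\<And>x y. x \<in> ucarrier A \<Longrightarrow> y \<in> ucarrier A \<Longrightarrow>
      (\<theta> `` {x}, \<theta> `` {y}) \<in> quot_cong \<theta> \<gamma> \<longleftrightarrow> (x, y) \<in> \<gamma>" by (rule img(2))
qed

text \<open>Pullback along the quotient map: the inverse of \<open>quot_cong\<close> \<theta> on the
  congruences above \<theta>.\<close>

definition lift_cong :: "('f, 'a) alg \<Rightarrow> ('a \<times> 'a) set \<Rightarrow> ('a set \<times> 'a set) set \<Rightarrow> ('a \<times> 'a) set"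
  where "lift_cong A \<theta> \<beta> = {(x, y) \<in> ucarrier A \<times> ucarrier A. (\<theta> `` {x}, \<theta> `` {y}) \<in> \<beta>}"

lemma lift_cong_in_Con:
  assumes "algebra S A" "\<theta> \<in> Con S A" "\<beta> \<in> Con S (quot_alg A \<theta>)"
  shows "lift_cong A \<theta> \<beta> \<in> Con S A"
  unfolding lift_cong_def by (rule surj_hom_vimage[OF surj_hom_quot_alg]) (use assms in auto)

lemma ucarrier_quot_alg: "ucarrier (quot_alg A \<theta>) = (\<lambda>x. \<theta> `` {x}) ` ucarrier A"
  by (auto simp: quot_alg_def quotient_def)

lemma le_lift_cong:
  assumes \<theta>: "\<theta> \<in> Con S A" and \<beta>: "\<beta> \<in> Con S (quot_alg A \<theta>)"
  shows "\<theta> \<subseteq> lift_cong A \<theta> \<beta>"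
proof
  fix p assume "p \<in> \<theta>"
  then obtain x y where p: "p = (x, y)" "(x, y) \<in> \<theta>" "x \<in> ucarrier A" "y \<in> ucarrier A"
    using Con_subset[OF \<theta>] by auto
  then have "\<theta> `` {x} = \<theta> `` {y}" using equiv_class_eq[OF Con_equiv[OF \<theta>]] by blast
  moreover have "(\<theta> `` {y}, \<theta> `` {y}) \<in> \<beta>"
    using p by (intro Con_refl[OF \<beta>]) (auto simp: ucarrier_quot_alg)
  ultimately show "p \<in> lift_cong A \<theta> \<beta>" using p by (auto simp: lift_cong_def)
qed

lemma quot_lift_cong:
  assumes \<beta>: "\<beta> \<in> Con S (quot_alg A \<theta>)"
  shows "quot_cong \<theta> (lift_cong A \<theta> \<beta>) = \<beta>"
  using Con_subset[OF \<beta>] unfolding quot_cong_def lift_cong_def ucarrier_quot_alg by blast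

lemma lift_cong_Nabla: "lift_cong A \<theta> (Nabla (quot_alg A \<theta>)) = Nabla A"
  by (auto simp: lift_cong_def Nabla_def ucarrier_quot_alg)

lemma lift_cong_Delta:
  assumes \<theta>: "\<theta> \<in> Con S A"
  shows "lift_cong A \<theta> (Delta (quot_alg A \<theta>)) = \<theta>"
proof -
  have "(\<theta> `` {x}, \<theta> `` {y}) \<in> Delta (quot_alg A \<theta>) \<longleftrightarrow> (x, y) \<in> \<theta>"
    if "x \<in> ucarrier A" "y \<in> ucarrier A" for x y
    using that eq_equiv_class_iff[OF Con_equiv[OF \<theta>] that]
    unfolding Delta_def ucarrier_quot_alg Id_on_iff by blast
  then show ?thesis using Con_subset[OF \<theta>] unfolding lift_cong_def by auto
qed

lemma lift_quot_cong:
  assumes "algebra S A" "\<theta> \<in> Con S A" "\<gamma> \<in> Con S A" "\<theta> \<subseteq> \<gamma>"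
  shows "lift_cong A \<theta> (quot_cong \<theta> \<gamma>) = \<gamma>"
  using quot_cong_in_Con(2)[OF assms] Con_subset[OF assms(3)] unfolding lift_cong_def by auto

lemma lift_cong_Int: "lift_cong A \<theta> (\<alpha> \<inter> \<beta>) = lift_cong A \<theta> \<alpha> \<inter> lift_cong A \<theta> \<beta>"
  unfolding lift_cong_def by auto

lemma lift_cong_mono: "\<alpha> \<subseteq> \<beta> \<Longrightarrow> lift_cong A \<theta> \<alpha> \<subseteq> lift_cong A \<theta> \<beta>"
  unfolding lift_cong_def by auto

lemma quot_cong_mono: "\<alpha> \<subseteq> \<beta> \<Longrightarrow> quot_cong \<theta> \<alpha> \<subseteq> quot_cong \<theta> \<beta>"
  unfolding quot_cong_def by auto

text \<open>The congruences of the quotient form the interval from \<theta> to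
  \<open>Nabla A\<close>, so complements in the quotient are pairs with join \<open>Nabla A\<close>
  and meet \<theta>. Joins are transferred through their universal property, by testing an arbitrary
  upper bound \<psi>.\<close>

lemma BoolCon_quot_iff:
  assumes A: "algebra S A" and \<theta>: "\<theta> \<in> Con S A"
  shows "\<beta> \<in> BoolCon S (quot_alg A \<theta>) \<longleftrightarrow>
    (\<exists>\<gamma>\<in>Con S A. \<exists>\<delta>\<in>Con S A. cjoin S A \<gamma> \<delta> = Nabla A \<and> \<gamma> \<inter> \<delta> = \<theta> \<and> \<beta> = quot_cong \<theta> \<gamma>)"
    (is "?L \<longleftrightarrow> ?R")
proof
  have Q: "algebra S (quot_alg A \<theta>)" using surj_hom_quot_alg[OF \<theta>] A by (rule surj_hom_algebra)
  note lC = lift_cong_in_Con[OF A \<theta>]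
  {
    assume ?L
    then obtain \<beta>' where b: "\<beta> \<in> Con S (quot_alg A \<theta>)" "\<beta>' \<in> Con S (quot_alg A \<theta>)"
      "cjoin S (quot_alg A \<theta>) \<beta> \<beta>' = Nabla (quot_alg A \<theta>)" "\<beta> \<inter> \<beta>' = Delta (quot_alg A \<theta>)"
      unfolding BoolCon_def by blast
    have "cjoin S A (lift_cong A \<theta> \<beta>) (lift_cong A \<theta> \<beta>') = Nabla A"
    proof (rule cjoin_eq_NablaI[OF A])
      fix \<psi> assume \<psi>: "\<psi> \<in> Con S A" "lift_cong A \<theta> \<beta> \<subseteq> \<psi>" "lift_cong A \<theta> \<beta>' \<subseteq> \<psi>"
      then have le: "\<theta> \<subseteq> \<psi>" using le_lift_cong[OF \<theta> b(1)] by blast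
      have "\<beta> \<subseteq> quot_cong \<theta> \<psi>" "\<beta>' \<subseteq> quot_cong \<theta> \<psi>"
        using quot_cong_mono[OF \<psi>(2)] quot_cong_mono[OF \<psi>(3)] quot_lift_cong b by metis+
      then have "Nabla (quot_alg A \<theta>) \<subseteq> quot_cong \<theta> \<psi>"
        using cjoin_least quot_cong_in_Con(1)[OF A \<theta> \<psi>(1) le] b(3) by metis
      then have "Nabla A \<subseteq> \<psi>"
        using lift_cong_mono lift_cong_Nabla lift_quot_cong[OF A \<theta> \<psi>(1) le] by metis
      then show "\<psi> = Nabla A" using Con_le_Nabla[OF \<psi>(1)] by auto
    qed (use lC b in auto)
    moreover have "lift_cong A \<theta> \<beta> \<inter> lift_cong A \<theta> \<beta>' = \<theta>"
      using b(4) lift_cong_Int lift_cong_Delta[OF \<theta>] by metis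
    ultimately show ?R using lC b quot_lift_cong by metis
  }
  assume ?R
  then obtain \<gamma> \<delta> where c: "\<gamma> \<in> Con S A" "\<delta> \<in> Con S A" "cjoin S A \<gamma> \<delta> = Nabla A"
    "\<gamma> \<inter> \<delta> = \<theta>" "\<beta> = quot_cong \<theta> \<gamma>" by blast
  have le: "\<theta> \<subseteq> \<gamma>" "\<theta> \<subseteq> \<delta>" using c by auto
  note qC = quot_cong_in_Con(1)[OF A \<theta> c(1) le(1)] quot_cong_in_Con(1)[OF A \<theta> c(2) le(2)]
  have "cjoin S (quot_alg A \<theta>) (quot_cong \<theta> \<gamma>) (quot_cong \<theta> \<delta>) = Nabla (quot_alg A \<theta>)"
  proof (rule cjoin_eq_NablaI[OF Q _ qC])
    fix \<psi> assume \<psi>: "\<psi> \<in> Con S (quot_alg A \<theta>)" "quot_cong \<theta> \<gamma> \<subseteq> \<psi>" "quot_cong \<theta> \<delta> \<subseteq> \<psi>"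
    have "\<gamma> \<subseteq> lift_cong A \<theta> \<psi>" "\<delta> \<subseteq> lift_cong A \<theta> \<psi>"
      using lift_cong_mono[OF \<psi>(2)] lift_cong_mono[OF \<psi>(3)]
        lift_quot_cong[OF A \<theta> c(1) le(1)] lift_quot_cong[OF A \<theta> c(2) le(2)] by metis+
    then have "Nabla A \<subseteq> lift_cong A \<theta> \<psi>" using cjoin_least lC[OF \<psi>(1)] c(3) by metis
    then show "\<psi> = Nabla (quot_alg A \<theta>)"
      using Con_le_Nabla[OF \<psi>(1)] unfolding lift_cong_def Nabla_def ucarrier_quot_alg by auto
  qed
  moreover have "quot_cong \<theta> \<gamma> \<inter> quot_cong \<theta> \<delta> = Delta (quot_alg A \<theta>)"
  proof -
    \<comment> \<open>It is enough to compare the pullbacks, since \<open>quot_lift_cong\<close>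
      makes \<open>lift_cong\<close> injective on congruences.\<close>
    have "lift_cong A \<theta> (quot_cong \<theta> \<gamma> \<inter> quot_cong \<theta> \<delta>) = lift_cong A \<theta> (Delta (quot_alg A \<theta>))"
      using lift_cong_Int lift_quot_cong[OF A \<theta> c(1) le(1)] lift_quot_cong[OF A \<theta> c(2) le(2)]
        lift_cong_Delta[OF \<theta>] c(4) by metis
    then show ?thesis using quot_lift_cong Con_Int[OF Q qC] Delta_in_Con[OF Q] by metis
  qed
  ultimately show ?L using qC c(5) unfolding BoolCon_def by blast
qed

section \<open>Matrices and the term condition\<close>

text \<open>Up to currying, these are the matrices with rows \<open>(t(a,c), t(a,d))\<close> and
  \<open>(t(b,c), t(b,d))\<close> of the term condition.  As a relation between rows, they form a reflexive
  compatible relation on \<open>\<beta>\<close>, regarded as a subalgebra of \<open>A \<times> A\<close>.\<close>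

inductive_set matrices ::
  "'f sig \<Rightarrow> ('f, 'a) alg \<Rightarrow> ('a \<times> 'a) set \<Rightarrow> ('a \<times> 'a) set \<Rightarrow> (('a \<times> 'a) \<times> ('a \<times> 'a)) set"
  for S A \<alpha> \<beta> where
  diag: "(x, y) \<in> \<alpha> \<Longrightarrow> ((x, x), (y, y)) \<in> matrices S A \<alpha> \<beta>"
| row: "(x, y) \<in> \<beta> \<Longrightarrow> ((x, y), (x, y)) \<in> matrices S A \<alpha> \<beta>"
| op: "f \<in> syms S \<Longrightarrow> length ps = arity S f \<Longrightarrow>
    list_all2 (\<lambda>p q. (p, q) \<in> matrices S A \<alpha> \<beta>) ps qs \<Longrightarrow>
    ((uop A f (map fst ps), uop A f (map snd ps)), (uop A f (map fst qs), uop A f (map snd qs)))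
      \<in> matrices S A \<alpha> \<beta>"

section \<open>Matrices generated by operations and matrices given by terms\<close>

fun rename :: "(nat \<Rightarrow> nat) \<Rightarrow> 'f trm \<Rightarrow> 'f trm" where
  "rename \<sigma> (Var i) = Var (\<sigma> i)"
| "rename \<sigma> (App f ts) = App f (map (rename \<sigma>) ts)"

lemma eval_rename: "eval A v (rename \<sigma> t) = eval A (\<lambda>i. v (\<sigma> i)) t"
  by (induction t) (auto simp: comp_def cong: map_cong)

lemma vars_rename: "vars (rename \<sigma> t) = \<sigma> ` vars t"
  by (induction t) auto

lemma wf_trm_rename: "wf_trm S t \<Longrightarrow> wf_trm S (rename \<sigma> t)"
  by (induction t) (auto simp: list_all_iff)

lemma eval_cong: "(\<And>i. i \<in> vars t \<Longrightarrow> v i = w i) \<Longrightarrow> eval A v t = eval A w t"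
proof (induction t)
  case (App f ts)
  then have "map (eval A v) ts = map (eval A w) ts" by auto
  then show ?case by (simp only: eval.simps)
qed simp

text \<open>\<open>params\<close> and \<open>row_of\<close> isolate the parameter condition and the
  rows of the matrix in \<open>centralizes\<close>, so that several terms can be brought to common
  parameters.\<close>

definition params :: "('a \<times> 'a) set \<Rightarrow> ('a \<times> 'a) set \<Rightarrow> 'a list \<Rightarrow> 'a list \<Rightarrow> 'a list \<Rightarrow> 'a list \<Rightarrow> bool"
  where "params \<alpha> \<beta> a b c d \<longleftrightarrow>
    list_all2 (\<lambda>x y. (x, y) \<in> \<alpha>) a b \<and> list_all2 (\<lambda>x y. (x, y) \<in> \<beta>) c d"

definition row_of :: "('f, 'a) alg \<Rightarrow> 'a list \<Rightarrow> 'a list \<Rightarrow> 'a list \<Rightarrow> 'f trm \<Rightarrow> 'a \<times> 'a" where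
  "row_of A a c d t = (eval A (nth (a @ c)) t, eval A (nth (a @ d)) t)"

text \<open>Inserting \<open>a'\<close> behind \<open>a\<close> leaves the positions of
  \<open>a\<close> alone and shifts those of \<open>c\<close> by \<open>length a'\<close>.\<close>

lemma eval_rename_left:
  assumes "vars t \<subseteq> {..<length a + length c}" "length a = n" "length a' = m"
  shows "eval A (nth ((a @ a') @ (c @ c'))) (rename (\<lambda>i. if i < n then i else i + m) t)
    = eval A (nth (a @ c)) t"
  unfolding eval_rename
proof (rule eval_cong)
  fix i assume "i \<in> vars t"
  then show "((a @ a') @ c @ c') ! (if i < n then i else i + m) = (a @ c) ! i"
    using assms by (cases "i < n") (auto simp: nth_append)
qed

text \<open>The block \<open>a'\<close> now starts behind \<open>a\<close>, and \<open>c'\<close>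
  starts behind \<open>a\<close>, \<open>a'\<close> and \<open>c\<close>. A position in
  \<open>c'\<close> already counts the length of \<open>a'\<close>, so it moves only by the lengths
  \<open>m\<close> and \<open>k\<close> of \<open>a\<close> and \<open>c\<close>.\<close>

lemma eval_rename_right:
  assumes "vars t \<subseteq> {..<length a' + length c'}" "length a' = n" "length a = m" "length c = k"
  shows "eval A (nth ((a @ a') @ (c @ c'))) (rename (\<lambda>i. if i < n then m + i else m + (k + i)) t)
    = eval A (nth (a' @ c')) t"
  unfolding eval_rename
proof (rule eval_cong)
  fix i assume "i \<in> vars t"
  show "((a @ a') @ c @ c') ! (if i < n then m + i else m + (k + i)) = (a' @ c') ! i"
  proof (cases "i < n")
    case True
    then show ?thesis using assms by (simp add: nth_append)
  next
    case False
    then obtain j where j: "i = length a' + j" using assms(2) le_Suc_ex[of n i] by auto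
    have "m + (k + i) = length (a @ a') + (length c + j)" using assms(3,4) j by simp
    then have "((a @ a') @ c @ c') ! (m + (k + i)) = c' ! j"
      unfolding nth_append_length_plus by (metis nth_append_length_plus)
    moreover have "(a' @ c') ! i = c' ! j" unfolding j by (rule nth_append_length_plus)
    ultimately show ?thesis using False by (metis (full_types))
  qed
qed

text \<open>An operation symbol can be applied to several terms only if they share their parameters.
  Concatenating the parameter lists and renaming variables achieves this.\<close>

lemma merge_params:
  assumes "list_all2 (\<lambda>p q. \<exists>t a b c d. params \<alpha> \<beta> a b c d \<and> wf_trm S t \<and>
      vars t \<subseteq> {..<length a + length c} \<and> p = row_of A a c d t \<and> q = row_of A b c d t) ps qs"
  shows "\<exists>ts a b c d. params \<alpha> \<beta> a b c d \<and> (\<forall>t\<in>set ts. wf_trm S t \<and>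
      vars t \<subseteq> {..<length a + length c}) \<and> ps = map (row_of A a c d) ts \<and> qs = map (row_of A b c d) ts"
  using assms
proof (induction rule: list_all2_induct)
  case Nil
  show ?case by (rule exI[of _ "[]"], rule exI[of _ "[]"], rule exI[of _ "[]"],
        rule exI[of _ "[]"], rule exI[of _ "[]"]) (simp add: params_def)
next
  case (Cons p ps q qs)
  then obtain t a b c d ts a' b' c' d'
    where t: "params \<alpha> \<beta> a b c d" "wf_trm S t" "vars t \<subseteq> {..<length a + length c}"
      "p = row_of A a c d t" "q = row_of A b c d t"
    and ts: "params \<alpha> \<beta> a' b' c' d'" "\<And>t. t \<in> set ts \<Longrightarrow> wf_trm S t"
      "\<And>t. t \<in> set ts \<Longrightarrow> vars t \<subseteq> {..<length a' + length c'}"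
      "ps = map (row_of A a' c' d') ts" "qs = map (row_of A b' c' d') ts"
    by (elim exE conjE) blast
  have len: "length a = length b" "length c = length d" "length a' = length b'" "length c' = length d'"
    using t(1) ts(1) by (auto simp: params_def dest: list_all2_lengthD)
  define \<sigma> where "\<sigma> = (\<lambda>i. if i < length a then i else i + length a')"
  define \<tau> where "\<tau> = (\<lambda>i. if i < length a' then length a + i else length a + (length c + i))"
  have par: "params \<alpha> \<beta> (a @ a') (b @ b') (c @ c') (d @ d')"
    using t(1) ts(1) by (auto simp: params_def intro: list_all2_appendI)
  have l: "row_of A (a @ a') (c @ c') (d @ d') (rename \<sigma> t) = row_of A a c d t"
    "row_of A (b @ b') (c @ c') (d @ d') (rename \<sigma> t) = row_of A b c d t"
    unfolding row_of_def \<sigma>_def using t(3) len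
    by (auto intro!: eval_rename_left simp del: append_assoc)
  have r: "row_of A (a @ a') (c @ c') (d @ d') (rename \<tau> s) = row_of A a' c' d' s"
    "row_of A (b @ b') (c @ c') (d @ d') (rename \<tau> s) = row_of A b' c' d' s" if "s \<in> set ts" for s
    unfolding row_of_def \<tau>_def using ts(3)[OF that] len
    by (auto intro!: eval_rename_right simp del: append_assoc)
  have v: "vars (rename \<sigma> t) \<subseteq> {..<length (a @ a') + length (c @ c')}"
    using t(3) unfolding vars_rename \<sigma>_def by auto
  have v': "vars (rename \<tau> s) \<subseteq> {..<length (a @ a') + length (c @ c')}" if "s \<in> set ts" for s
    using ts(3)[OF that] unfolding vars_rename \<tau>_def by auto
  have "\<forall>s\<in>set (rename \<sigma> t # map (rename \<tau>) ts). wf_trm S s \<and>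
      vars s \<subseteq> {..<length (a @ a') + length (c @ c')}"
    using t(2) ts(2) v v' by (auto intro: wf_trm_rename)
  moreover have "p # ps = map (row_of A (a @ a') (c @ c') (d @ d')) (rename \<sigma> t # map (rename \<tau>) ts)"
    "q # qs = map (row_of A (b @ b') (c @ c') (d @ d')) (rename \<sigma> t # map (rename \<tau>) ts)"
    using t(4,5) ts(4,5) l r by simp_all
  ultimately show ?case using par
    by (intro exI[of _ "rename \<sigma> t # map (rename \<tau>) ts"] exI[of _ "a @ a'"] exI[of _ "b @ b'"]
        exI[of _ "c @ c'"] exI[of _ "d @ d'"] conjI) assumption+
qed

text \<open>With \<open>term_matrices\<close> this shows that the inductive closure consists exactly
  of the matrices of the term condition. The two kinds of generators come from the term
  \<open>Var 0\<close> with a single parameter.\<close>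

lemma matrices_term:
  assumes "(p, q) \<in> matrices S A \<alpha> \<beta>"
  shows "\<exists>t a b c d. params \<alpha> \<beta> a b c d \<and> wf_trm S t \<and>
      vars t \<subseteq> {..<length a + length c} \<and> p = row_of A a c d t \<and> q = row_of A b c d t"
  using assms
proof induction
  case (diag x y)
  show ?case
    by (rule exI[of _ "Var 0"], rule exI[of _ "[x]"], rule exI[of _ "[y]"],
        rule exI[of _ "[]"], rule exI[of _ "[]"]) (use diag in \<open>simp add: params_def row_of_def\<close>)
next
  case (row x y)
  show ?case
    by (rule exI[of _ "Var 0"], rule exI[of _ "[]"], rule exI[of _ "[]"],
        rule exI[of _ "[x]"], rule exI[of _ "[y]"]) (use row in \<open>simp add: params_def row_of_def\<close>)
next
  case (op f ps qs)
  have "list_all2 (\<lambda>p q. \<exists>t a b c d. params \<alpha> \<beta> a b c d \<and> wf_trm S t \<and>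
      vars t \<subseteq> {..<length a + length c} \<and> p = row_of A a c d t \<and> q = row_of A b c d t) ps qs"
    using op(3) by (rule list_all2_mono) blast
  then obtain ts a b c d where ts: "params \<alpha> \<beta> a b c d" "\<forall>t\<in>set ts. wf_trm S t \<and>
      vars t \<subseteq> {..<length a + length c}" "ps = map (row_of A a c d) ts" "qs = map (row_of A b c d) ts"
    using merge_params by blast
  show ?case
    by (rule exI[of _ "App f ts"], rule exI[of _ a], rule exI[of _ b],
        rule exI[of _ c], rule exI[of _ d])
      (use op ts in \<open>auto simp: row_of_def comp_def list_all_iff\<close>)
qed

lemma term_matrices:
  assumes "params \<alpha> \<beta> a b c d" "wf_trm S t" "vars t \<subseteq> {..<length a + length c}"
  shows "(row_of A a c d t, row_of A b c d t) \<in> matrices S A \<alpha> \<beta>"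
  using assms(2,3)
proof (induction t)
  case (Var i)
  have len: "length a = length b" "length c = length d"
    using assms(1) by (auto simp: params_def dest: list_all2_lengthD)
  show ?case
  proof (cases "i < length a")
    case True
    then have "(a ! i, b ! i) \<in> \<alpha>" using assms(1) list_all2_nthD[of "\<lambda>x y. (x, y) \<in> \<alpha>" a b i] by (simp add: params_def)
    then show ?thesis using True len by (auto simp: row_of_def nth_append intro: matrices.diag)
  next
    case False
    then have "(c ! (i - length a), d ! (i - length a)) \<in> \<beta>"
      using assms(1) Var list_all2_nthD[of "\<lambda>x y. (x, y) \<in> \<beta>" c d "i - length a"] by (auto simp: params_def)
    then show ?thesis using False len by (auto simp: row_of_def nth_append intro: matrices.row)
  qed
next
  case (App f ts)
  have "list_all2 (\<lambda>p q. (p, q) \<in> matrices S A \<alpha> \<beta>) (map (row_of A a c d) ts) (map (row_of A b c d) ts)"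
    using App by (auto simp: list_all2_conv_all_nth list_all_iff UN_subset_iff)
  then show ?case using matrices.op[of f S "map (row_of A a c d) ts" A \<alpha> \<beta> "map (row_of A b c d) ts"]
      App.prems by (simp add: row_of_def comp_def)
qed

lemma matrices_sym:
  assumes "\<And>x y. (x, y) \<in> \<alpha> \<Longrightarrow> (y, x) \<in> \<alpha>" and "(p, q) \<in> matrices S A \<alpha> \<beta>"
  shows "(q, p) \<in> matrices S A \<alpha> \<beta>"
  using assms(2)
proof induction
  case (op f ps qs)
  have "list_all2 (\<lambda>p q. (p, q) \<in> matrices S A \<alpha> \<beta>) qs ps"
    using op(3) by (induction rule: list_all2_induct) auto
  then show ?case using op list_all2_lengthD[OF op(3)] by (intro matrices.op) auto
qed (auto intro: matrices.intros assms(1))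

lemma matrices_related:
  assumes \<alpha>: "\<alpha> \<in> Con S A" and \<beta>: "\<beta> \<in> Con S A" and "((p, q), (r, s)) \<in> matrices S A \<alpha> \<beta>"
  shows "(p, q) \<in> \<beta>" "(r, s) \<in> \<beta>" "(p, r) \<in> \<alpha>" "(q, s) \<in> \<alpha>"
proof -
  have "P \<in> \<beta> \<and> Q \<in> \<beta> \<and> (fst P, fst Q) \<in> \<alpha> \<and> (snd P, snd Q) \<in> \<alpha>"
    if "(P, Q) \<in> matrices S A \<alpha> \<beta>" for P Q
    using that
  proof induction
    case (diag x y)
    then show ?case using Con_subset[OF \<alpha>] Con_refl[OF \<beta>] by auto
  next
    case (row x y)
    then show ?case using Con_subset[OF \<beta>] Con_refl[OF \<alpha>] by auto
  next
    case (op f ps qs)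
    note len = list_all2_lengthD[OF op(3)]
    have l: "i < length ps \<Longrightarrow> ps ! i \<in> \<beta> \<and> qs ! i \<in> \<beta> \<and> (fst (ps ! i), fst (qs ! i)) \<in> \<alpha> \<and>
        (snd (ps ! i), snd (qs ! i)) \<in> \<alpha>" for i
      using list_all2_nthD[OF op(3), of i] by simp
    show ?case using op(1,2) l len
      by (auto intro!: Con_op[OF \<beta>] Con_op[OF \<alpha>] simp: list_all2_conv_all_nth)
  qed
  from this[OF assms(3)] show "(p, q) \<in> \<beta>" "(r, s) \<in> \<beta>" "(p, r) \<in> \<alpha>" "(q, s) \<in> \<alpha>" by simp_all
qed

text \<open>This turns the term condition into closure of \<delta>, as a set of rows, under one
  relation on \<beta>. Such a closure passes to the transitive closure of the relation.\<close>

lemma centralizes_iff_matrices: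
  assumes \<alpha>: "\<alpha> \<in> Con S A" and \<beta>: "\<beta> \<in> Con S A"
  shows "centralizes S A \<alpha> \<beta> \<delta> \<longleftrightarrow> matrices S A \<alpha> \<beta> `` \<delta> \<subseteq> \<delta>"
proof
  assume C: "centralizes S A \<alpha> \<beta> \<delta>"
  show "matrices S A \<alpha> \<beta> `` \<delta> \<subseteq> \<delta>"
  proof
    fix q assume "q \<in> matrices S A \<alpha> \<beta> `` \<delta>"
    then obtain p where p: "p \<in> \<delta>" "(p, q) \<in> matrices S A \<alpha> \<beta>" by auto
    obtain t a b c d where t: "params \<alpha> \<beta> a b c d" "wf_trm S t"
      "vars t \<subseteq> {..<length a + length c}" "p = row_of A a c d t" "q = row_of A b c d t"
      using matrices_term[OF p(2)] by blast
    have l: "list_all2 (\<lambda>x y. (x, y) \<in> \<alpha>) a b" "list_all2 (\<lambda>x y. (x, y) \<in> \<beta>) c d"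
      using t(1) by (auto simp: params_def)
    note c = list_all2_subset[OF l(1) Con_subset[OF \<alpha>]] list_all2_subset[OF l(2) Con_subset[OF \<beta>]]
      list_all2_lengthD[OF l(1)] list_all2_lengthD[OF l(2)]
    show "q \<in> \<delta>"
      using C[unfolded centralizes_def, rule_format, of t a c b d] c l t p(1)
      by (simp add: row_of_def)
  qed
next
  assume C: "matrices S A \<alpha> \<beta> `` \<delta> \<subseteq> \<delta>"
  show "centralizes S A \<alpha> \<beta> \<delta>"
    unfolding centralizes_def
  proof (intro allI impI, elim conjE)
    fix t a b c d
    assume "wf_trm S t" "vars t \<subseteq> {..<length a + length c}"
      "list_all2 (\<lambda>x y. (x, y) \<in> \<alpha>) a b" "list_all2 (\<lambda>x y. (x, y) \<in> \<beta>) c d"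
    then have "(row_of A a c d t, row_of A b c d t) \<in> matrices S A \<alpha> \<beta>"
      by (intro term_matrices) (simp_all add: params_def)
    moreover assume "(eval A (nth (a @ c)) t, eval A (nth (a @ d)) t) \<in> \<delta>"
    ultimately show "(eval A (nth (b @ c)) t, eval A (nth (b @ d)) t) \<in> \<delta>"
      using C by (auto simp: row_of_def)
  qed
qed

text \<open>Closure under a relation survives intersections, so the commutator belongs to the family
  of which it is the least member.\<close>

lemma comm_centralized:
  assumes \<alpha>: "\<alpha> \<in> Con S A" and \<beta>: "\<beta> \<in> Con S A"
  shows "matrices S A \<alpha> \<beta> `` comm S A \<alpha> \<beta> \<subseteq> comm S A \<alpha> \<beta>"
proof
  fix R assume "R \<in> matrices S A \<alpha> \<beta> `` comm S A \<alpha> \<beta>"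
  then obtain P where P: "(P, R) \<in> matrices S A \<alpha> \<beta>" "P \<in> comm S A \<alpha> \<beta>" by auto
  \<comment> \<open>This takes care of the factor \<open>Nabla A\<close> in
    \<open>comm\<close>.\<close>
  have "R \<in> \<beta>" using matrices_related(2)[OF \<alpha> \<beta>, of "fst P" "snd P" "fst R" "snd R"] P(1) by simp
  moreover have "R \<in> \<delta>" if "\<delta> \<in> Con S A" "matrices S A \<alpha> \<beta> `` \<delta> \<subseteq> \<delta>" for \<delta>
    using P that unfolding comm_def centralizes_iff_matrices[OF \<alpha> \<beta>] by blast
  ultimately show "R \<in> comm S A \<alpha> \<beta>"
    using Con_le_Nabla[OF \<beta>] unfolding comm_def centralizes_iff_matrices[OF \<alpha> \<beta>] by blast
qed

section \<open>A congruence as a subalgebra of the square of \<open>A\<close>\<close>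

definition pair_alg :: "('f, 'a) alg \<Rightarrow> ('a \<times> 'a) set \<Rightarrow> ('f, 'a \<times> 'a) alg" where
  "pair_alg A \<beta> = \<lparr> ucarrier = \<beta>, uop = (\<lambda>f ps. (uop A f (map fst ps), uop A f (map snd ps))) \<rparr>"

lemma ucarrier_pair_alg [simp]: "ucarrier (pair_alg A \<beta>) = \<beta>"
  by (simp add: pair_alg_def)

lemma uop_pair_alg [simp]: "uop (pair_alg A \<beta>) f ps = (uop A f (map fst ps), uop A f (map snd ps))"
  by (simp add: pair_alg_def)

lemma algebra_pair_alg:
  assumes A: "algebra S A" and \<beta>: "\<beta> \<in> Con S A"
  shows "algebra S (pair_alg A \<beta>)"
proof -
  have "\<beta> \<noteq> {}" using A Con_refl[OF \<beta>] unfolding algebra_def by blast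
  moreover have "(uop A f (map fst ps), uop A f (map snd ps)) \<in> \<beta>"
    if "f \<in> syms S" "length ps = arity S f" "set ps \<subseteq> \<beta>" for f ps
    using that(1,2) subsetD[OF that(3) nth_mem]
    by (intro Con_op[OF \<beta>]) (auto simp: list_all2_conv_all_nth)
  ultimately show ?thesis unfolding algebra_def by simp
qed

lemma eval_pair_alg:
  "eval (pair_alg A \<beta>) v t = (eval A (\<lambda>i. fst (v i)) t, eval A (\<lambda>i. snd (v i)) t)"
proof (induction t)
  case (App f ts)
  then have "map fst (map (eval (pair_alg A \<beta>) v) ts) = map (eval A (\<lambda>i. fst (v i))) ts"
    "map snd (map (eval (pair_alg A \<beta>) v) ts) = map (eval A (\<lambda>i. snd (v i))) ts" by auto
  then show ?case by (simp del: map_map)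
qed simp

lemma inV_pair_alg:
  assumes A: "inV S Eqs A" and \<beta>: "\<beta> \<in> Con S A"
  shows "inV S Eqs (pair_alg A \<beta>)"
  unfolding inV_def satisfies_def
proof (intro conjI ballI allI impI)
  show "algebra S (pair_alg A \<beta>)" using A \<beta> by (intro algebra_pair_alg) (auto simp: inV_def)
  fix e and v :: "nat \<Rightarrow> _" assume e: "e \<in> Eqs" and "\<forall>i. v i \<in> ucarrier (pair_alg A \<beta>)"
  then have v: "v i \<in> ucarrier A \<times> ucarrier A" for i using Con_subset[OF \<beta>] by auto
  have "fst (v i) \<in> ucarrier A" "snd (v i) \<in> ucarrier A" for i using v[of i] by auto
  then show "eval (pair_alg A \<beta>) v (fst e) = eval (pair_alg A \<beta>) v (snd e)"
    unfolding eval_pair_alg using A e by (simp add: inV_def satisfies_def)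
qed

text \<open>The unchanged arguments are rows in \<beta>, and \<open>matrices.row\<close> relates
  each of them to itself.\<close>

lemma matrices_translation:
  assumes "(x, y) \<in> matrices S A \<alpha> \<beta>" "f \<in> syms S" "length (us @ x # vs) = arity S f"
    "set us \<subseteq> \<beta>" "set vs \<subseteq> \<beta>"
  shows "(uop (pair_alg A \<beta>) f (us @ x # vs), uop (pair_alg A \<beta>) f (us @ y # vs)) \<in> matrices S A \<alpha> \<beta>"
proof -
  have "list_all2 (\<lambda>p q. (p, q) \<in> matrices S A \<alpha> \<beta>) (us @ x # vs) (us @ y # vs)"
    using assms by (intro list_all2_appendI list_all2_Cons[THEN iffD2] conjI)
      (auto intro!: list_all2_reflI_on[where X = \<beta>] intro: matrices.row)
  from matrices.op[OF assms(2,3) this] show ?thesis by simp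
qed

text \<open>Rows of \<beta> are related to themselves in both families, so a translation sends a
  step of either family to a step of the same family. Only transitivity has to be added to the
  union. The case of equal \<alpha> and \<gamma> treats a single family.\<close>

lemma matrices_Un_trancl_in_Con:
  assumes A: "algebra S A" and \<beta>: "\<beta> \<in> Con S A" and \<alpha>: "\<alpha> \<in> Con S A" "\<gamma> \<in> Con S A"
  shows "(matrices S A \<alpha> \<beta> \<union> matrices S A \<gamma> \<beta>)\<^sup>+ \<in> Con S (pair_alg A \<beta>)" (is "?R\<^sup>+ \<in> _")
proof (rule trancl_in_Con[OF algebra_pair_alg[OF A \<beta>]])
  show "?R \<subseteq> ucarrier (pair_alg A \<beta>) \<times> ucarrier (pair_alg A \<beta>)"
    using matrices_related(1,2)[OF _ \<beta>] \<alpha> by fastforce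
  show "(x, x) \<in> ?R" if "x \<in> ucarrier (pair_alg A \<beta>)" for x
    using that matrices.row[of "fst x" "snd x" \<beta> S A \<alpha>] by simp
  show "sym ?R" using \<alpha> by (auto intro!: symI intro: matrices_sym Con_sym)
  fix f us x y vs
  assume *: "f \<in> syms S" "length (us @ x # vs) = arity S f"
    "set us \<subseteq> ucarrier (pair_alg A \<beta>)" "set vs \<subseteq> ucarrier (pair_alg A \<beta>)"
  assume "(x, y) \<in> ?R"
  then show "(uop (pair_alg A \<beta>) f (us @ x # vs), uop (pair_alg A \<beta>) f (us @ y # vs)) \<in> ?R"
    using matrices_translation[OF _ *(1,2), of y A _ \<beta>] *(3,4) unfolding ucarrier_pair_alg by blast
qed

lemma trancl_Image_subset:
  assumes "R `` X \<subseteq> X"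
  shows "R\<^sup>+ `` X \<subseteq> X"
proof -
  have "R\<^sup>+ `` X \<subseteq> R\<^sup>* `` X" by (intro Image_mono) (auto dest: trancl_into_rtrancl)
  then show ?thesis unfolding Image_closed_trancl[OF assms] .
qed

section \<open>The shifting lemma\<close>

text \<open>Gumm's rectangle principle, stated for one algebra. It mentions no joins, which makes it
  easy to transport along an injective relabelling.\<close>

definition shifting :: "'f sig \<Rightarrow> ('f, 'a) alg \<Rightarrow> bool" where
  "shifting S A \<longleftrightarrow> (\<forall>\<alpha>\<in>Con S A. \<forall>\<beta>\<in>Con S A. \<forall>\<gamma>\<in>Con S A. \<alpha> \<inter> \<beta> \<subseteq> \<gamma> \<longrightarrow>
     (\<forall>x y u v. (x, y) \<in> \<alpha> \<and> (u, v) \<in> \<alpha> \<and> (x, u) \<in> \<beta> \<and> (y, v) \<in> \<beta> \<and> (u, v) \<in> \<gamma> \<longrightarrow> (x, y) \<in> \<gamma>))"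

lemma shiftingD:
  assumes "shifting S A" "\<alpha> \<in> Con S A" "\<beta> \<in> Con S A" "\<gamma> \<in> Con S A" "\<alpha> \<inter> \<beta> \<subseteq> \<gamma>"
    "(x, y) \<in> \<alpha>" "(u, v) \<in> \<alpha>" "(x, u) \<in> \<beta>" "(y, v) \<in> \<beta>" "(u, v) \<in> \<gamma>"
  shows "(x, y) \<in> \<gamma>"
  using assms(1)[unfolded shifting_def, rule_format, OF assms(2-5)] assms(6-10) by blast

text \<open>The path from x over u and v to y lies in the join of \<alpha> \<inter> \<gamma> and
  \<beta>. As \<alpha> \<inter> \<gamma> \<subseteq> \<alpha>, the modular law cuts this join down
  by \<alpha> to a congruence below \<gamma>.\<close>

lemma modular_imp_shifting:
  assumes A: "algebra S A" and mod: "modular_Con S A"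
  shows "shifting S A"
  unfolding shifting_def
proof (intro ballI allI impI, elim conjE)
  fix \<alpha> \<beta> \<gamma> x y u v
  assume C: "\<alpha> \<in> Con S A" "\<beta> \<in> Con S A" "\<gamma> \<in> Con S A" and le: "\<alpha> \<inter> \<beta> \<subseteq> \<gamma>"
    and xy: "(x, y) \<in> \<alpha>" "(u, v) \<in> \<alpha>" "(x, u) \<in> \<beta>" "(y, v) \<in> \<beta>" "(u, v) \<in> \<gamma>"
  note ag = Con_Int[OF A C(1,3)]
  note J = cjoin_in_Con[OF A, of "\<alpha> \<inter> \<gamma>" \<beta>] and up = cjoin_upper[OF ag C(2)]
  have "(x, u) \<in> cjoin S A (\<alpha> \<inter> \<gamma>) \<beta>" "(u, v) \<in> cjoin S A (\<alpha> \<inter> \<gamma>) \<beta>"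
    "(v, y) \<in> cjoin S A (\<alpha> \<inter> \<gamma>) \<beta>"
    using up xy Con_sym[OF C(2)] by blast+
  then have "(x, y) \<in> cjoin S A (\<alpha> \<inter> \<gamma>) \<beta> \<inter> \<alpha>" using Con_trans[OF J] xy(1) by blast
  also have "\<dots> = cjoin S A (\<alpha> \<inter> \<gamma>) (\<beta> \<inter> \<alpha>)"
    using mod[unfolded modular_Con_def, rule_format, OF ag C(2) C(1)] by simp
  also have "\<dots> \<subseteq> \<gamma>" using le by (intro cjoin_least[OF C(3)]) auto
  finally show "(x, y) \<in> \<gamma>" .
qed

lemma Delta_eq_kernel: "inj_on h (ucarrier A) \<Longrightarrow>
    {(x, y) \<in> ucarrier A \<times> ucarrier A. h x = h y} = Delta A"
  by (auto simp: Delta_def dest: inj_onD)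

text \<open>For injective \<open>h\<close>, taking images of congruences commutes with intersection
  and reflects membership, so the principle pulls back from the copy.\<close>

lemma shifting_image_alg:
  assumes A: "algebra S A" and inj: "inj_on h (ucarrier A)" and sh: "shifting S (image_alg A h)"
  shows "shifting S A"
  unfolding shifting_def
proof (intro ballI allI impI, elim conjE)
  fix \<alpha> \<beta> \<gamma> x y u v
  assume C: "\<alpha> \<in> Con S A" "\<beta> \<in> Con S A" "\<gamma> \<in> Con S A" and le: "\<alpha> \<inter> \<beta> \<subseteq> \<gamma>"
    and xy: "(x, y) \<in> \<alpha>" "(u, v) \<in> \<alpha>" "(x, u) \<in> \<beta>" "(y, v) \<in> \<beta>" "(u, v) \<in> \<gamma>"
  have h: "surj_hom S A (image_alg A h) h"
    by (rule surj_hom_image_alg) (simp only: Delta_eq_kernel[OF inj] Delta_in_Con[OF A])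
  have ker: "(x, y) \<in> \<theta>" if "\<theta> \<in> Con S A" "x \<in> ucarrier A" "y \<in> ucarrier A" "h x = h y" for \<theta> x y
    using that inj Con_refl[OF that(1)] by (auto dest: inj_onD)
  note img = surj_hom_image[OF h A _ ker]
  have inj2: "inj_on (map_prod h h) (ucarrier A \<times> ucarrier A)" using inj by (rule map_prod_inj_on[OF _ inj])
  have "map_prod h h ` \<alpha> \<inter> map_prod h h ` \<beta> = map_prod h h ` (\<alpha> \<inter> \<beta>)"
    using inj_on_image_Int[OF inj2 Con_subset[OF C(1)] Con_subset[OF C(2)]] by simp
  then have "map_prod h h ` \<alpha> \<inter> map_prod h h ` \<beta> \<subseteq> map_prod h h ` \<gamma>" using le by auto
  then have "(h x, h y) \<in> map_prod h h ` \<gamma>"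
    using shiftingD[OF sh img(1)[OF C(1) C(1)] img(1)[OF C(2) C(2)] img(1)[OF C(3) C(3)],
        of "h x" "h y" "h u" "h v"] xy by blast
  moreover have "x \<in> ucarrier A" "y \<in> ucarrier A" using xy(1) Con_subset[OF C(1)] by auto
  ultimately show "(x, y) \<in> \<gamma>" by (simp only: img(2)[OF C(3) C(3)])
qed

text \<open>A matrix is a rectangle with rows in \<beta> and columns in \<alpha>. The shifting
  lemma, with the roles of \<alpha> and \<beta> exchanged, moves \<delta> from the first row to the
  second.\<close>

lemma shifting_imp_centralized:
  assumes sh: "shifting S A" and C: "\<alpha> \<in> Con S A" "\<beta> \<in> Con S A" "\<delta> \<in> Con S A"
    and le: "\<alpha> \<inter> \<beta> \<subseteq> \<delta>"
  shows "matrices S A \<alpha> \<beta> `` \<delta> \<subseteq> \<delta>"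
proof
  fix R assume "R \<in> matrices S A \<alpha> \<beta> `` \<delta>"
  then obtain p q r s where R: "R = (r, s)" "((p, q), (r, s)) \<in> matrices S A \<alpha> \<beta>" "(p, q) \<in> \<delta>"
    by (cases R) auto
  note rel = matrices_related[OF C(1,2) R(2)]
  have "\<beta> \<inter> \<alpha> \<subseteq> \<delta>" using le by auto
  then have "(r, s) \<in> \<delta>"
    by (rule shiftingD[OF sh C(2,1,3)]) (use rel R(3) Con_sym[OF C(1)] in auto)
  then show "R \<in> \<delta>" using R by simp
qed

lemma comm_le_Int:
  assumes A: "algebra S A" and sh: "shifting S A" and C: "\<alpha> \<in> Con S A" "\<beta> \<in> Con S A"
  shows "comm S A \<alpha> \<beta> \<subseteq> \<alpha> \<inter> \<beta>"
  using shifting_imp_centralized[OF sh C Con_Int[OF A C]] Con_Int[OF A C]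
  unfolding comm_def centralizes_iff_matrices[OF C] by blast

text \<open>The first application of the shifting lemma in the algebra \<open>\<beta>\<close> gives
  \<open>\<Delta> \<inter> \<eta>\<^sub>0 \<subseteq> \<delta>\<^sub>1\<close> for the congruence \<open>\<Delta>\<close> generated by the matrices, the kernel \<open>\<eta>\<^sub>0\<close> of the first
  projection and the pullback \<open>\<delta>\<^sub>1\<close> of \<open>\<delta>\<close> along the second one; the second application then moves
  \<open>\<delta>\<^sub>1\<close> along \<open>\<Delta>\<close>.\<close>

lemma centralized_mono:
  assumes A: "algebra S A" and sh: "shifting S (pair_alg A \<beta>)"
    and C: "\<alpha> \<in> Con S A" "\<beta> \<in> Con S A" "\<delta> \<in> Con S A"
    and cent: "matrices S A \<alpha> \<beta> `` \<gamma> \<subseteq> \<gamma>" and refl: "Delta A \<subseteq> \<gamma>" and le: "\<gamma> \<subseteq> \<delta>"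
  shows "matrices S A \<alpha> \<beta> `` \<delta> \<subseteq> \<delta>"
proof
  define P where "P = pair_alg A \<beta>"
  have P: "algebra S P" "ucarrier P = \<beta>" using algebra_pair_alg[OF A C(2)] by (auto simp: P_def)
  define \<Delta> where "\<Delta> = (matrices S A \<alpha> \<beta>)\<^sup>+"
  have D: "\<Delta> \<in> Con S P"
    using matrices_Un_trancl_in_Con[OF A C(2) C(1) C(1)] by (simp add: \<Delta>_def P_def)
  have D\<gamma>: "\<Delta> `` \<gamma> \<subseteq> \<gamma>" unfolding \<Delta>_def using cent by (rule trancl_Image_subset)
  \<comment> \<open>Both projections from \<beta> to \<open>A\<close> are surjective because \<beta>
    is reflexive, so congruences of \<open>A\<close> can be pulled back along them.\<close>
  have pull: "{(p, q) \<in> \<beta> \<times> \<beta>. (\<pi> p, \<pi> q) \<in> \<theta>} \<in> Con S P"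
    if \<pi>: "\<pi> = fst \<or> \<pi> = snd" and \<theta>: "\<theta> \<in> Con S A" for \<pi> \<theta>
  proof -
    have "surj_hom S P A \<pi>"
      unfolding surj_hom_def
    proof (intro conjI ballI allI impI)
      show "\<pi> ` ucarrier P = ucarrier A"
        using \<pi> Con_subset[OF C(2)] Con_refl[OF C(2)] unfolding P(2) by force
    qed (use \<pi> in \<open>auto simp: P_def\<close>)
    from surj_hom_vimage[OF this P(1) \<theta>] show ?thesis by (simp add: P(2))
  qed
  define \<eta>0 where "\<eta>0 = {(p, q) \<in> \<beta> \<times> \<beta>. (fst p, fst q) \<in> Delta A}"
  define \<eta>1 where "\<eta>1 = {(p, q) \<in> \<beta> \<times> \<beta>. (snd p, snd q) \<in> Delta A}"
  define \<delta>1 where "\<delta>1 = {(p, q) \<in> \<beta> \<times> \<beta>. (snd p, snd q) \<in> \<delta>}"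
  have E: "\<eta>0 \<in> Con S P" "\<eta>1 \<in> Con S P" "\<delta>1 \<in> Con S P"
    unfolding \<eta>0_def \<eta>1_def \<delta>1_def using pull Delta_in_Con[OF A] C(3) by blast+
  note sh' = sh[folded P_def]
  note carr = subsetD[OF Con_subset[OF C(2)]]
  have E01: "\<eta>0 \<inter> \<eta>1 \<subseteq> \<Delta>"
    using Con_refl[OF D] unfolding \<eta>0_def \<eta>1_def P(2) Delta_def by auto
  have D0: "\<eta>0 \<inter> \<Delta> \<subseteq> \<delta>1"
  proof
    fix R assume R: "R \<in> \<eta>0 \<inter> \<Delta>"
    then obtain p q q' where R': "R = ((p, q), (p, q'))" "(p, q) \<in> \<beta>" "(p, q') \<in> \<beta>"
      unfolding \<eta>0_def Delta_def by auto
    have in\<beta>: "(q, q) \<in> \<beta>" "(q, q') \<in> \<beta>" "p \<in> ucarrier A" "q \<in> ucarrier A" "q' \<in> ucarrier A"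
      using R' Con_sym[OF C(2)] Con_trans[OF C(2)] carr by blast+
    \<comment> \<open>The rectangle has \<open>\<eta>0\<close>-sides from (p, q) to (p, q') and from
      (q, q) to (q, q'); its \<open>\<eta>1\<close>-sides change the first coordinate between p and
      q. Then \<Delta> leads from a diagonal pair, hence from \<gamma>, to (q, q').\<close>
    have "((q, q), (q, q')) \<in> \<Delta>"
      by (rule shiftingD[OF sh' E(1,2) D E01, of _ _ "(p, q)" "(p, q')"])
        (use R R' in\<beta> in \<open>auto simp: \<eta>0_def \<eta>1_def Delta_def\<close>)
    moreover have "(q, q) \<in> \<gamma>" using refl in\<beta> by (auto simp: Delta_def)
    ultimately have "(q, q') \<in> \<delta>" using D\<gamma> le by blast
    then show "R \<in> \<delta>1" using R' by (simp add: \<delta>1_def)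
  qed
  fix R assume "R \<in> matrices S A \<alpha> \<beta> `` \<delta>"
  then obtain u v u' v' where R: "R = (u', v')" "((u, v), (u', v')) \<in> matrices S A \<alpha> \<beta>" "(u, v) \<in> \<delta>"
    by (cases R) auto
  note rel = matrices_related[OF C(1,2) R(2)]
  have c: "u \<in> ucarrier A" "u' \<in> ucarrier A" using rel carr by blast+
  then have cb: "(u, u) \<in> \<beta>" "(u', u') \<in> \<beta>" using Con_refl[OF C(2)] by auto
  \<comment> \<open>The second rectangle: its \<Delta>-sides are the matrix from (u, u) to (u', u')
    and the given one from (u, v) to (u', v'); its \<open>\<eta>0\<close>-sides join the two rows
    over u and the two rows over u'.\<close>
  have "((u, u), (u', u')) \<in> \<Delta>" "((u, v), (u', v')) \<in> \<Delta>"
    using matrices.diag[OF rel(3)] R(2) unfolding \<Delta>_def by blast+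
  note \<Delta>_sides = this[THEN Con_sym[OF D]]
  have "((u', u'), (u', v')) \<in> \<eta>0" "((u, u), (u, v)) \<in> \<eta>0" "((u, u), (u, v)) \<in> \<delta>1"
    using rel R(3) c cb by (simp_all add: \<eta>0_def \<delta>1_def Delta_def Id_on_iff)
  then have "((u', u'), (u', v')) \<in> \<delta>1"
    using shiftingD[OF sh' E(1) D E(3) D0 _ _ \<Delta>_sides] by blast
  then show "R \<in> \<delta>" using R by (simp add: \<delta>1_def)
qed

section \<open>Semidegenerate congruence modular varieties\<close>

text \<open>The conditions on the variety quantify over algebras carried by \<open>'a\<close> only.
  As \<open>'a\<close> is infinite, pairs can be coded in it, so subalgebras of the square and their
  quotients have isomorphic copies on \<open>'a\<close>.\<close>

locale modular_semidegenerate =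
  fixes S :: "'f sig" and Eqs :: "('f trm \<times> 'f trm) set" and A :: "('f, 'a) alg"
  assumes finite_sig: "finite (syms S)"
    and wf_eqs: "\<forall>e\<in>Eqs. wf_trm S (fst e) \<and> wf_trm S (snd e)"
    and big_type: "infinite (UNIV :: 'a set)"
    and cong_modular: "\<forall>B :: ('f, 'a) alg. inV S Eqs B \<longrightarrow> modular_Con S B"
    and semidegenerate: "\<forall>B :: ('f, 'a) alg. inV S Eqs B \<and> nontrivial_alg B \<longrightarrow> \<not> has_one_elem_subalg S B"
    and A_in_V: "inV S Eqs A"
begin

lemma algebra_A: "algebra S A"
  using A_in_V by (simp add: inV_def)

lemma shifting_A: "shifting S A"
  using modular_imp_shifting[OF algebra_A] cong_modular A_in_V by blast

lemma pair_code: obtains j :: "'a \<times> 'a \<Rightarrow> 'a" where "inj j"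
proof -
  obtain j where "bij_betw j (UNIV \<times> UNIV :: ('a \<times> 'a) set) (UNIV :: 'a set)"
    using card_of_ordIso[THEN iffD2, OF card_of_Times_same_infinite[OF big_type]] by blast
  then show ?thesis using that by (auto simp: bij_betw_def)
qed

text \<open>Modularity is available for the copy of \<open>pair_alg\<close> on \<open>'a\<close>;
  its shifting property is then pulled back along the coding.\<close>

lemma shifting_pair_alg:
  assumes "\<beta> \<in> Con S A"
  shows "shifting S (pair_alg A \<beta>)"
proof -
  obtain j :: "'a \<times> 'a \<Rightarrow> 'a" where "inj j" by (rule pair_code)
  then have inj: "inj_on j (ucarrier (pair_alg A \<beta>))" by (auto intro: inj_on_subset)
  note P = algebra_pair_alg[OF algebra_A assms]
  have "surj_hom S (pair_alg A \<beta>) (image_alg (pair_alg A \<beta>) j) j"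
    by (rule surj_hom_image_alg) (simp only: Delta_eq_kernel[OF inj] Delta_in_Con[OF P])
  then have "inV S Eqs (image_alg (pair_alg A \<beta>) j)"
    using inV_pair_alg[OF A_in_V assms] wf_eqs by (rule surj_hom_inV)
  then have "shifting S (image_alg (pair_alg A \<beta>) j)"
    using modular_imp_shifting cong_modular unfolding inV_def by blast
  then show ?thesis by (rule shifting_image_alg[OF P inj])
qed

text \<open>The class of \<open>e\<close> is a one-element subalgebra of the quotient, so
  semidegeneracy makes the quotient trivial. The type \<open>'b\<close> is kept general so that this
  applies both to \<open>A\<close> and to \<open>pair_alg\<close>.\<close>

lemma one_elem_class_imp_Nabla:
  fixes B :: "('f, 'b) alg" and j :: "'b \<Rightarrow> 'a"
  assumes j: "inj j" and B: "inV S Eqs B" and \<theta>: "\<theta> \<in> Con S B" and e: "e \<in> ucarrier B"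
    and idem: "\<And>f. f \<in> syms S \<Longrightarrow> (uop B f (replicate (arity S f) e), e) \<in> \<theta>"
  shows "\<theta> = Nabla B"
proof -
  \<comment> \<open>Related elements have the same class, hence the same chosen representative. So
    the kernel of \<open>h\<close> is \<theta>, and \<open>image_alg B h\<close> is a copy of the
    quotient carried by \<open>'a\<close>.\<close>
  define h where "h x = j (SOME y. (x, y) \<in> \<theta>)" for x
  have h_iff: "h x = h y \<longleftrightarrow> (x, y) \<in> \<theta>" if xy: "x \<in> ucarrier B" "y \<in> ucarrier B" for x y
  proof
    assume "h x = h y"
    then have eq: "(SOME z. (x, z) \<in> \<theta>) = (SOME z. (y, z) \<in> \<theta>)" using j by (simp add: h_def inj_eq)
    have "(x, SOME z. (x, z) \<in> \<theta>) \<in> \<theta>" "(y, SOME z. (y, z) \<in> \<theta>) \<in> \<theta>"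
      using Con_refl[OF \<theta>] xy someI[of "\<lambda>z. (x, z) \<in> \<theta>" x] someI[of "\<lambda>z. (y, z) \<in> \<theta>" y] by auto
    then show "(x, y) \<in> \<theta>" using eq Con_sym[OF \<theta>] Con_trans[OF \<theta>] by metis
  next
    assume "(x, y) \<in> \<theta>"
    then have "(x, z) \<in> \<theta> \<longleftrightarrow> (y, z) \<in> \<theta>" for z using Con_sym[OF \<theta>] Con_trans[OF \<theta>] by blast
    then show "h x = h y" by (simp add: h_def)
  qed
  have "{(x, y) \<in> ucarrier B \<times> ucarrier B. h x = h y} = \<theta>" using h_iff Con_subset[OF \<theta>] by auto
  then have hom: "surj_hom S B (image_alg B h) h" using \<theta> by (intro surj_hom_image_alg) simp
  have "has_one_elem_subalg S (image_alg B h)"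
    unfolding has_one_elem_subalg_def
  proof (intro bexI[of _ "h e"] ballI)
    fix f assume f: "f \<in> syms S"
    have "uop B f (replicate (arity S f) e) \<in> ucarrier B" using idem[OF f] Con_subset[OF \<theta>] by auto
    then have "h (uop B f (replicate (arity S f) e)) = h e" using h_iff idem[OF f] e by blast
    moreover have "h (uop B f (replicate (arity S f) e)) =
        uop (image_alg B h) f (map h (replicate (arity S f) e))"
      using hom f e unfolding surj_hom_def
      by (metis length_replicate set_replicate_conv_if empty_subsetI insert_subset)
    ultimately show "uop (image_alg B h) f (replicate (arity S f) (h e)) = h e" by simp
  qed (use e in \<open>simp add: image_alg_def\<close>)
  then have "\<not> nontrivial_alg (image_alg B h)"
    using semidegenerate surj_hom_inV[OF hom B wf_eqs] by blast
  then have "h x = h y" if "x \<in> ucarrier B" "y \<in> ucarrier B" for x y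
  proof -
    have "h x \<in> ucarrier (image_alg B h)" "h y \<in> ucarrier (image_alg B h)"
      using that by (simp_all add: image_alg_def)
    then show ?thesis using \<open>\<not> nontrivial_alg _\<close> unfolding nontrivial_alg_def by blast
  qed
  then have "Nabla B \<subseteq> \<theta>" using h_iff unfolding Nabla_def by auto
  then show ?thesis using Con_le_Nabla[OF \<theta>] by blast
qed

text \<open>The congruence generated by both families of matrices identifies the whole diagonal of
  \<open>\<beta>\<close>, hence its quotient has a one-element subalgebra and is trivial.  So \<open>\<delta> \<inter> \<beta>\<close>, a union of classes,
  is all of \<open>\<beta>\<close>.\<close>

lemma centralized_by_Nabla:
  assumes C: "\<alpha> \<in> Con S A" "\<gamma> \<in> Con S A" "\<beta> \<in> Con S A" "\<delta> \<in> Con S A"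
    and J: "cjoin S A \<alpha> \<gamma> = Nabla A"
    and cent: "matrices S A \<alpha> \<beta> `` \<delta> \<subseteq> \<delta>" "matrices S A \<gamma> \<beta> `` \<delta> \<subseteq> \<delta>"
  shows "\<beta> \<subseteq> \<delta>"
proof -
  define \<Theta> where "\<Theta> = (matrices S A \<alpha> \<beta> \<union> matrices S A \<gamma> \<beta>)\<^sup>+"
  have \<Theta>: "\<Theta> \<in> Con S (pair_alg A \<beta>)"
    unfolding \<Theta>_def by (rule matrices_Un_trancl_in_Con[OF algebra_A C(3,1,2)])
  have \<Theta>\<delta>: "\<Theta> `` \<delta> \<subseteq> \<delta>" unfolding \<Theta>_def using cent by (intro trancl_Image_subset) auto
  \<comment> \<open>The restriction of \<Theta> to the diagonal, read as a congruence of
    \<open>A\<close>. It contains \<alpha> and \<gamma> through the generators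
    \<open>matrices.diag\<close>, hence their join.\<close>
  define \<psi> where "\<psi> = {(x, y) \<in> ucarrier A \<times> ucarrier A. ((x, x), (y, y)) \<in> \<Theta>}"
  have "\<psi> \<in> Con S A"
  proof (rule ConI)
    fix f xs ys
    assume f: "f \<in> syms S" "length xs = arity S f" "length ys = arity S f"
      and l: "list_all2 (\<lambda>x y. (x, y) \<in> \<psi>) xs ys"
    have "list_all2 (\<lambda>x y. (x, y) \<in> \<Theta>) (map (\<lambda>x. (x, x)) xs) (map (\<lambda>x. (x, x)) ys)"
      using l by (auto simp: list_all2_map1 list_all2_map2 \<psi>_def elim: list_all2_mono)
    then have "(uop (pair_alg A \<beta>) f (map (\<lambda>x. (x, x)) xs), uop (pair_alg A \<beta>) f (map (\<lambda>x. (x, x)) ys)) \<in> \<Theta>"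
      using f by (intro Con_op[OF \<Theta>]) auto
    moreover have "set xs \<subseteq> ucarrier A" "set ys \<subseteq> ucarrier A"
      using list_all2_subset[OF l, of "ucarrier A" "ucarrier A"] by (auto simp: \<psi>_def)
    ultimately show "(uop A f xs, uop A f ys) \<in> \<psi>"
      using f algebra_op[OF algebra_A] by (simp add: \<psi>_def comp_def)
  next
    show "\<And>x. x \<in> ucarrier A \<Longrightarrow> (x, x) \<in> \<psi>"
      using Con_refl[OF \<Theta>] Con_refl[OF C(3)] by (auto simp: \<psi>_def)
    show "\<And>x y. (x, y) \<in> \<psi> \<Longrightarrow> (y, x) \<in> \<psi>" using Con_sym[OF \<Theta>] by (auto simp: \<psi>_def)
    show "\<And>x y z. (x, y) \<in> \<psi> \<Longrightarrow> (y, z) \<in> \<psi> \<Longrightarrow> (x, z) \<in> \<psi>"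
      using Con_trans[OF \<Theta>] unfolding \<psi>_def by blast
  qed (auto simp: \<psi>_def)
  moreover have "\<alpha> \<subseteq> \<psi>"
    using Con_subset[OF C(1)] by (auto simp: \<psi>_def \<Theta>_def intro!: r_into_trancl matrices.diag)
  moreover have "\<gamma> \<subseteq> \<psi>"
    using Con_subset[OF C(2)] by (auto simp: \<psi>_def \<Theta>_def intro!: r_into_trancl intro: matrices.diag)
  ultimately have "Nabla A \<subseteq> \<psi>" using cjoin_least J by metis
  then have diag: "((x, x), (y, y)) \<in> \<Theta>" if "x \<in> ucarrier A" "y \<in> ucarrier A" for x y
    using that by (auto simp: Nabla_def \<psi>_def)
  obtain e where e: "e \<in> ucarrier A" using algebra_A by (auto simp: algebra_def)
  obtain j :: "'a \<times> 'a \<Rightarrow> 'a" where j: "inj j" by (rule pair_code)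
  \<comment> \<open>An operation applied to copies of (e, e) stays on the diagonal, which lies in a
    single \<Theta>-class.\<close>
  have "(uop (pair_alg A \<beta>) f (replicate (arity S f) (e, e)), (e, e)) \<in> \<Theta>" if "f \<in> syms S" for f
    using e that algebra_op[OF algebra_A that, of "replicate (arity S f) e"]
    by (auto intro!: diag simp: set_replicate_conv_if)
  then have full: "\<Theta> = Nabla (pair_alg A \<beta>)"
    using one_elem_class_imp_Nabla[OF j inV_pair_alg[OF A_in_V C(3)] \<Theta>, of "(e, e)"]
      Con_refl[OF C(3) e] by simp
  show ?thesis
  proof
    fix p assume "p \<in> \<beta>"
    then have "((e, e), p) \<in> \<Theta>" using full Con_refl[OF C(3) e] by (simp add: Nabla_def)
    then show "p \<in> \<delta>" using \<Theta>\<delta> Con_refl[OF C(4) e] by blast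
  qed
qed

text \<open>A substitute for distributivity: both \<alpha> \<inter> \<beta> and \<gamma> \<inter>
  \<beta> lie below \<delta>, so \<alpha> and \<gamma> each centralize \<beta> modulo
  \<delta>.\<close>

lemma comaximal_distrib:
  assumes C: "\<alpha> \<in> Con S A" "\<gamma> \<in> Con S A" "\<beta> \<in> Con S A" "\<delta> \<in> Con S A"
    and J: "cjoin S A \<alpha> \<gamma> = Nabla A" and le: "\<alpha> \<inter> \<beta> \<subseteq> \<delta>" "\<gamma> \<subseteq> \<delta>"
  shows "\<beta> \<subseteq> \<delta>"
  using shifting_imp_centralized[OF shifting_A C(1,3,4)] shifting_imp_centralized[OF shifting_A C(2,3,4)] le
  by (intro centralized_by_Nabla[OF C J]) auto

text \<open>If \<alpha> is not below the maximal \<phi>, their join is \<open>Nabla A\<close>.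
  Modulo \<phi>, \<beta> is centralized by \<alpha> since the commutator lies in \<phi>, and by
  \<phi> itself, so \<open>centralized_by_Nabla\<close> puts \<beta> below \<phi>.\<close>

lemma Max_subset_Spec: "Max S A \<subseteq> Spec S A"
proof
  fix \<phi> assume "\<phi> \<in> Max S A"
  then have \<phi>: "\<phi> \<in> Con S A" "\<phi> \<noteq> Nabla A"
    "\<And>\<psi>. \<psi> \<in> Con S A \<Longrightarrow> \<phi> \<subseteq> \<psi> \<Longrightarrow> \<psi> = \<phi> \<or> \<psi> = Nabla A"
    unfolding Max_def by blast+
  have "\<beta> \<subseteq> \<phi>" if C: "\<alpha> \<in> Con S A" "\<beta> \<in> Con S A" and le: "comm S A \<alpha> \<beta> \<subseteq> \<phi>" and n: "\<not> \<alpha> \<subseteq> \<phi>" for \<alpha> \<beta>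
  proof (rule centralized_by_Nabla[OF C(1) \<phi>(1) C(2) \<phi>(1)])
    show "cjoin S A \<alpha> \<phi> = Nabla A"
      using \<phi>(3)[OF cjoin_in_Con[OF algebra_A]] cjoin_upper[OF C(1) \<phi>(1)] n by blast
    \<comment> \<open>Reflexivity of the commutator is what \<open>centralized_mono\<close> asks for
      in order to pass from it to the larger \<phi>.\<close>
    have "Delta A \<subseteq> comm S A \<alpha> \<beta>" using Delta_le_Con Nabla_in_Con[OF algebra_A] unfolding comm_def by blast
    then show "matrices S A \<alpha> \<beta> `` \<phi> \<subseteq> \<phi>"
      by (rule centralized_mono[OF algebra_A shifting_pair_alg[OF C(2)] C \<phi>(1) comm_centralized[OF C] _ le])
    show "matrices S A \<phi> \<beta> `` \<phi> \<subseteq> \<phi>"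
      by (rule shifting_imp_centralized[OF shifting_A \<phi>(1) C(2) \<phi>(1)]) auto
  qed
  then show "\<phi> \<in> Spec S A" using \<phi>(1,2) unfolding Spec_def prime_cong_def by blast
qed

text \<open>Zorn's lemma applies because \<open>Nabla A\<close> is generated by a finite set and so
  is not the union of a nonempty chain of proper congruences.\<close>

lemma ex_Max:
  assumes \<psi>: "\<psi> \<in> Con S A" "\<psi> \<noteq> Nabla A"
  shows "\<exists>\<phi>\<in>Max S A. \<psi> \<subseteq> \<phi>"
proof -
  obtain e where e: "e \<in> ucarrier A" using algebra_A by (auto simp: algebra_def)
  \<comment> \<open>One pair per operation symbol: a congruence containing all of them has a
    subalgebra as its class of \<open>e\<close>, hence is \<open>Nabla A\<close>.\<close>
  define G where "G = (\<lambda>f. (uop A f (replicate (arity S f) e), e)) ` syms S"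
  have fin: "finite G" using finite_sig by (simp add: G_def)
  have G: "\<theta> = Nabla A" if "\<theta> \<in> Con S A" "G \<subseteq> \<theta>" for \<theta>
    by (rule one_elem_class_imp_Nabla[OF inj_on_id A_in_V that(1) e]) (use that(2) in \<open>auto simp: G_def\<close>)
  have G_Nabla: "G \<subseteq> Nabla A"
    using e algebra_op[OF algebra_A] by (auto simp: G_def Nabla_def set_replicate_conv_if)
  define \<A> where "\<A> = {\<theta> \<in> Con S A. \<psi> \<subseteq> \<theta> \<and> \<theta> \<noteq> Nabla A}"
  have "\<exists>\<phi>\<in>\<A>. \<forall>\<theta>\<in>\<A>. \<phi> \<subseteq> \<theta> \<longrightarrow> \<theta> = \<phi>"
  proof (rule subset_Zorn_nonempty)
    show "\<A> \<noteq> {}" using \<psi> by (auto simp: \<A>_def)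
    fix \<C> assume ne: "\<C> \<noteq> {}" and ch: "subset.chain \<A> \<C>"
    have sub: "\<And>\<theta>. \<theta> \<in> \<C> \<Longrightarrow> \<theta> \<in> Con S A \<and> \<psi> \<subseteq> \<theta> \<and> \<theta> \<noteq> Nabla A"
      using ch unfolding subset.chain_def \<A>_def by blast
    have U: "\<Union>\<C> \<in> Con S A"
    proof (rule ConI_translations[OF algebra_A])
      show "\<Union>\<C> \<subseteq> ucarrier A \<times> ucarrier A"
        using sub Con_subset[of _ S A] by (intro Union_least) simp
      show "(x, x) \<in> \<Union>\<C>" if "x \<in> ucarrier A" for x
        using ne sub Con_refl[of _ S A, OF _ that] by auto
      show "(y, x) \<in> \<Union>\<C>" if "(x, y) \<in> \<Union>\<C>" for x y
      proof -
        obtain \<theta> where "\<theta> \<in> \<C>" "(x, y) \<in> \<theta>" using \<open>(x, y) \<in> \<Union>\<C>\<close> by blast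
        then show ?thesis using sub Con_sym[of \<theta> S A x y] by blast
      qed
    next
      fix x y z assume "(x, y) \<in> \<Union>\<C>" "(y, z) \<in> \<Union>\<C>"
      then have "{(x, y), (y, z)} \<subseteq> \<Union>\<C>" by simp
      then obtain \<theta> where "\<theta> \<in> \<C>" "{(x, y), (y, z)} \<subseteq> \<theta>"
        by (rule finite_subset_Union_chain[OF _ _ ne ch, rotated]) simp_all
      then show "(x, z) \<in> \<Union>\<C>" using sub Con_trans[of \<theta> S A x y z] by blast
    next
      fix f us x y vs
      assume *: "f \<in> syms S" "length (us @ x # vs) = arity S f"
        "set us \<subseteq> ucarrier A" "set vs \<subseteq> ucarrier A"
      assume "(x, y) \<in> \<Union>\<C>"
      then obtain \<theta> where "\<theta> \<in> \<C>" "(x, y) \<in> \<theta>" by blast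
      then show "(uop A f (us @ x # vs), uop A f (us @ y # vs)) \<in> \<Union>\<C>"
        using Con_translation[OF _ *, of \<theta> y] sub by blast
    qed
    have "\<Union>\<C> \<noteq> Nabla A"
    proof
      assume "\<Union>\<C> = Nabla A"
      then have "G \<subseteq> \<Union>\<C>" using G_Nabla by simp
      then obtain \<theta> where "\<theta> \<in> \<C>" "G \<subseteq> \<theta>"
        by (rule finite_subset_Union_chain[OF fin _ ne ch])
      then show False using sub G by blast
    qed
    then show "\<Union>\<C> \<in> \<A>" using U ne sub unfolding \<A>_def by blast
  qed
  then obtain \<phi> where \<phi>: "\<phi> \<in> \<A>" "\<And>\<theta>. \<theta> \<in> \<A> \<Longrightarrow> \<phi> \<subseteq> \<theta> \<Longrightarrow> \<theta> = \<phi>" by blast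
  then have "\<phi> \<in> Max S A" unfolding Max_def \<A>_def by blast
  then show ?thesis using \<phi>(1) unfolding \<A>_def by blast
qed

section \<open>The topology on the maximal congruences\<close>

text \<open>Primes are meet-prime because the commutator lies below the intersection.\<close>

lemma Spec_Int_le:
  assumes "\<phi> \<in> Spec S A" "\<alpha> \<in> Con S A" "\<beta> \<in> Con S A"
  shows "\<alpha> \<inter> \<beta> \<subseteq> \<phi> \<longleftrightarrow> \<alpha> \<subseteq> \<phi> \<or> \<beta> \<subseteq> \<phi>"
proof
  assume "\<alpha> \<inter> \<beta> \<subseteq> \<phi>"
  then have "comm S A \<alpha> \<beta> \<subseteq> \<phi>" using comm_le_Int[OF algebra_A shifting_A assms(2,3)] by blast
  then show "\<alpha> \<subseteq> \<phi> \<or> \<beta> \<subseteq> \<phi>" using assms unfolding Spec_def prime_cong_def by blast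
qed auto

lemma Spec_Con: "\<phi> \<in> Spec S A \<Longrightarrow> \<phi> \<in> Con S A"
  by (simp add: Spec_def prime_cong_def)

lemma D_Int: "\<alpha> \<in> Con S A \<Longrightarrow> \<beta> \<in> Con S A \<Longrightarrow> D S A (\<alpha> \<inter> \<beta>) = D S A \<alpha> \<inter> D S A \<beta>"
  using Spec_Int_le[of _ \<alpha> \<beta>] unfolding D_def by auto

lemma D_csup:
  assumes "\<Theta> \<subseteq> Con S A"
  shows "D S A (csup S A \<Theta>) = \<Union> (D S A ` \<Theta>)"
proof -
  have "csup S A \<Theta> \<subseteq> \<phi> \<longleftrightarrow> (\<forall>\<theta>\<in>\<Theta>. \<theta> \<subseteq> \<phi>)" if "\<phi> \<in> Spec S A" for \<phi>
  proof -
    have "\<Union>\<Theta> \<subseteq> csup S A \<Theta>"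
      unfolding csup_def using assms Con_le_Nabla[of _ S A] by (intro Cg_upper) blast
    moreover have "csup S A \<Theta> \<subseteq> \<phi>" if "\<Union>\<Theta> \<subseteq> \<phi>"
      unfolding csup_def using Spec_Con[OF \<open>\<phi> \<in> Spec S A\<close>] that by (rule Cg_least)
    ultimately show ?thesis by blast
  qed
  then show ?thesis unfolding D_def by blast
qed

text \<open>\<open>topology\<close> returns the given family only if it satisfies
  \<open>istopology\<close>; intersections come from \<open>D_Int\<close> and unions from
  \<open>D_csup\<close>.\<close>

lemma openin_spec_top: "openin (spec_top S A) U \<longleftrightarrow> (\<exists>\<theta>\<in>Con S A. U = D S A \<theta>)"
proof -
  have "istopology (\<lambda>U. \<exists>\<theta>\<in>Con S A. U = D S A \<theta>)"
    unfolding istopology_def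
  proof (intro conjI allI impI)
    fix U V
    assume "\<exists>\<theta>\<in>Con S A. U = D S A \<theta>" "\<exists>\<theta>\<in>Con S A. V = D S A \<theta>"
    then obtain \<alpha> \<beta> where "\<alpha> \<in> Con S A" "\<beta> \<in> Con S A" "U = D S A \<alpha>" "V = D S A \<beta>" by blast
    then show "\<exists>\<theta>\<in>Con S A. U \<inter> V = D S A \<theta>"
      by (intro bexI[of _ "\<alpha> \<inter> \<beta>"]) (simp_all add: D_Int Con_Int[OF algebra_A])
  next
    fix \<U>
    assume U: "\<forall>U\<in>\<U>. \<exists>\<theta>\<in>Con S A. U = D S A \<theta>"
    \<comment> \<open>Taking every congruence that represents a member of the family avoids a choice
      of representatives and also covers the empty union.\<close>
    define \<Theta> where "\<Theta> = {\<theta> \<in> Con S A. D S A \<theta> \<in> \<U>}"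
    have "D S A ` \<Theta> = \<U>" using U unfolding \<Theta>_def by auto
    then have "\<Union>\<U> = D S A (csup S A \<Theta>)" using D_csup[of \<Theta>] by (auto simp: \<Theta>_def)
    moreover have "csup S A \<Theta> \<in> Con S A" unfolding csup_def by (rule Cg_in_Con[OF algebra_A])
    ultimately show "\<exists>\<theta>\<in>Con S A. \<Union>\<U> = D S A \<theta>" by blast
  qed
  then show ?thesis unfolding spec_top_def by (simp add: topology_inverse')
qed

lemma D_Nabla: "D S A (Nabla A) = Spec S A"
  using Con_le_Nabla[of _ S A] unfolding D_def Spec_def prime_cong_def by auto

lemma topspace_spec_top: "topspace (spec_top S A) = Spec S A"
  unfolding topspace_def openin_spec_top using D_Nabla Nabla_in_Con[OF algebra_A] by (auto simp: D_def)

lemma topspace_max_top: "topspace (max_top S A) = Max S A"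
  using Max_subset_Spec by (auto simp: max_top_def topspace_spec_top)

lemma gmap_eq: "gmap S A \<theta> = {\<phi> \<in> Max S A. \<not> \<theta> \<subseteq> \<phi>}"
  using Max_subset_Spec by (auto simp: gmap_def D_def)

lemma openin_max_top: "openin (max_top S A) U \<longleftrightarrow> (\<exists>\<theta>\<in>Con S A. U = gmap S A \<theta>)"
  unfolding max_top_def openin_subtopology openin_spec_top gmap_def by (auto simp: Int_commute)

lemma Clop_max_top_iff:
  "U \<in> Clop (max_top S A) \<longleftrightarrow>
    (\<exists>\<gamma>\<in>Con S A. \<exists>\<delta>\<in>Con S A. U = gmap S A \<gamma> \<and> Max S A - U = gmap S A \<delta>)"
proof -
  have "U \<subseteq> Max S A" if "U = gmap S A \<gamma>" for \<gamma> using that by (auto simp: gmap_def)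
  then show ?thesis
    unfolding Clop_def closedin_def topspace_max_top openin_max_top by blast
qed

lemma Max_Con: "\<phi> \<in> Max S A \<Longrightarrow> \<phi> \<in> Con S A"
  by (simp add: Max_def)

section \<open>Comaximality tested on maximal congruences\<close>

lemma cjoin_not_le_Max:
  assumes "cjoin S A \<gamma> \<delta> = Nabla A" "\<phi> \<in> Max S A"
  shows "\<not> (\<gamma> \<subseteq> \<phi> \<and> \<delta> \<subseteq> \<phi>)"
proof
  assume "\<gamma> \<subseteq> \<phi> \<and> \<delta> \<subseteq> \<phi>"
  then have "Nabla A \<subseteq> \<phi>" using cjoin_least[OF Max_Con[OF assms(2)], of \<gamma> \<delta>] assms(1) by simp
  then show False using assms(2) Con_le_Nabla[OF Max_Con[OF assms(2)]] by (auto simp: Max_def)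
qed

lemma comaximalI:
  assumes "\<gamma> \<in> Con S A" "\<delta> \<in> Con S A" "\<And>\<phi>. \<phi> \<in> Max S A \<Longrightarrow> \<gamma> \<subseteq> \<phi> \<Longrightarrow> \<delta> \<subseteq> \<phi> \<Longrightarrow> False"
  shows "cjoin S A \<gamma> \<delta> = Nabla A"
proof (rule ccontr)
  assume "cjoin S A \<gamma> \<delta> \<noteq> Nabla A"
  then obtain \<phi> where "\<phi> \<in> Max S A" "cjoin S A \<gamma> \<delta> \<subseteq> \<phi>" using ex_Max cjoin_in_Con[OF algebra_A] by blast
  then show False using assms(3) cjoin_upper[OF assms(1,2)] by blast
qed

text \<open>Primeness puts at least one of \<gamma>, \<delta> below each maximal congruence,
  comaximality at most one. This serves both for meet \<open>Delta A\<close> and for meet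
  \<open>Rad S A\<close>.\<close>

lemma gmap_complement:
  assumes "\<gamma> \<in> Con S A" "\<delta> \<in> Con S A" "cjoin S A \<gamma> \<delta> = Nabla A"
    and "\<And>\<phi>. \<phi> \<in> Max S A \<Longrightarrow> \<gamma> \<inter> \<delta> \<subseteq> \<phi>"
  shows "Max S A - gmap S A \<gamma> = gmap S A \<delta>"
proof -
  have "\<gamma> \<subseteq> \<phi> \<longleftrightarrow> \<not> \<delta> \<subseteq> \<phi>" if "\<phi> \<in> Max S A" for \<phi>
    using Spec_Int_le[of \<phi> \<gamma> \<delta>] assms(1,2) assms(4)[OF that] cjoin_not_le_Max[OF assms(3) that]
      Max_subset_Spec that by blast
  then show ?thesis unfolding gmap_eq by blast
qed

section \<open>The radical, injectivity of \<open>gmap\<close>, and the two implications\<close>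

lemma Rad_in_Con: "Rad S A \<in> Con S A"
  unfolding Rad_def by (rule Con_Inter[OF algebra_A]) (auto simp: Max_def)

lemma Rad_le_Max: "\<phi> \<in> Max S A \<Longrightarrow> Rad S A \<subseteq> \<phi>"
  unfolding Rad_def by blast

lemma le_RadI: "\<theta> \<in> Con S A \<Longrightarrow> (\<And>\<phi>. \<phi> \<in> Max S A \<Longrightarrow> \<theta> \<subseteq> \<phi>) \<Longrightarrow> \<theta> \<subseteq> Rad S A"
  using Con_le_Nabla[of \<theta> S A] unfolding Rad_def by blast

lemma gmap_cjoin:
  assumes "\<alpha> \<in> Con S A" "\<beta> \<in> Con S A"
  shows "gmap S A (cjoin S A \<alpha> \<beta>) = gmap S A \<alpha> \<union> gmap S A \<beta>"
  using cjoin_le_iff[OF assms Max_Con] unfolding gmap_eq by auto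

lemma gmap_Rad: "gmap S A (Rad S A) = {}"
  using Rad_le_Max unfolding gmap_eq by blast

lemma BoolConD:
  assumes "\<alpha> \<in> BoolCon S A"
  obtains \<alpha>' where "\<alpha> \<in> Con S A" "\<alpha>' \<in> Con S A" "cjoin S A \<alpha> \<alpha>' = Nabla A" "\<alpha> \<inter> \<alpha>' = Delta A"
    "Max S A - gmap S A \<alpha> = gmap S A \<alpha>'"
proof -
  obtain \<alpha>' where *: "\<alpha> \<in> Con S A" "\<alpha>' \<in> Con S A" "cjoin S A \<alpha> \<alpha>' = Nabla A" "\<alpha> \<inter> \<alpha>' = Delta A"
    using assms unfolding BoolCon_def by blast
  moreover have "Max S A - gmap S A \<alpha> = gmap S A \<alpha>'"
    using * Delta_le_Con[OF Max_Con] by (intro gmap_complement) auto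
  ultimately show ?thesis using that by blast
qed

lemma cjoin_commute: "cjoin S A \<alpha> \<beta> = cjoin S A \<beta> \<alpha>"
  by (simp add: cjoin_def Un_commute)

text \<open>The complement of \<alpha> is comaximal with \<beta>: a maximal congruence above both
  would lie in \<open>gmap S A\<close> \<alpha> but not in \<open>gmap S A\<close> \<beta>. Then
  \<open>comaximal_distrib\<close> applies. Injectivity of \<open>gmap\<close> on
  \<open>BoolCon S A\<close> follows.\<close>

lemma le_if_gmap_le:
  assumes "\<alpha> \<in> BoolCon S A" "\<beta> \<in> Con S A" "gmap S A \<alpha> \<subseteq> gmap S A \<beta>"
  shows "\<alpha> \<subseteq> \<beta>"
proof -
  obtain \<alpha>' where \<alpha>': "\<alpha> \<in> Con S A" "\<alpha>' \<in> Con S A" "cjoin S A \<alpha> \<alpha>' = Nabla A" "\<alpha> \<inter> \<alpha>' = Delta A"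
    using BoolConD[OF assms(1)] by metis
  have "cjoin S A \<alpha>' \<beta> = Nabla A"
  proof (rule comaximalI[OF \<alpha>'(2) assms(2)])
    fix \<phi> assume \<phi>: "\<phi> \<in> Max S A" "\<alpha>' \<subseteq> \<phi>" "\<beta> \<subseteq> \<phi>"
    then have "\<not> \<alpha> \<subseteq> \<phi>" using cjoin_not_le_Max[OF \<alpha>'(3)] by blast
    then show False using \<phi> assms(3) unfolding gmap_eq by blast
  qed
  then show ?thesis
    using \<alpha>' assms(2) Delta_le_Con[OF assms(2)] by (intro comaximal_distrib[of \<alpha>' \<beta> \<alpha> \<beta>]) auto
qed

text \<open>The lifting property enters only in surjectivity: a clopen set and its complement give
  complements modulo the radical, and a lift of the first is a preimage.\<close>

lemma CBLP_imp_bool_iso: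
  assumes "CBLP S A (Rad S A)"
  shows "bool_iso S A (gmap S A)"
  unfolding bool_iso_def bij_betw_def
proof (intro conjI ballI)
  have BC: "\<alpha> \<in> Con S A" if "\<alpha> \<in> BoolCon S A" for \<alpha> using that by (simp add: BoolCon_def)
  show "inj_on (gmap S A) (BoolCon S A)"
    by (rule inj_onI) (use le_if_gmap_le BC in \<open>metis order_refl subset_antisym\<close>)
  show "gmap S A (Delta A) = {}"
    using Delta_le_Con[OF Max_Con] unfolding gmap_eq by blast
  show "gmap S A (Nabla A) = topspace (max_top S A)"
    using Max_subset_Spec unfolding gmap_def D_Nabla topspace_max_top by blast
  show "gmap S A (\<alpha> \<inter> \<beta>) = gmap S A \<alpha> \<inter> gmap S A \<beta>"
    "gmap S A (cjoin S A \<alpha> \<beta>) = gmap S A \<alpha> \<union> gmap S A \<beta>"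
    if "\<alpha> \<in> BoolCon S A" "\<beta> \<in> BoolCon S A" for \<alpha> \<beta>
    using D_Int[OF BC BC] gmap_cjoin[OF BC BC] that unfolding gmap_def by auto
  show "gmap S A ` BoolCon S A = Clop (max_top S A)"
  proof (intro equalityI subsetI)
    fix U assume "U \<in> gmap S A ` BoolCon S A"
    then obtain \<alpha> where "\<alpha> \<in> BoolCon S A" "U = gmap S A \<alpha>" by blast
    then show "U \<in> Clop (max_top S A)"
      unfolding Clop_max_top_iff using BoolConD[of \<alpha>] by metis
  next
    fix U assume "U \<in> Clop (max_top S A)"
    then obtain \<gamma>0 \<delta>0 where UV: "\<gamma>0 \<in> Con S A" "\<delta>0 \<in> Con S A"
      "U = gmap S A \<gamma>0" "Max S A - U = gmap S A \<delta>0"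
      unfolding Clop_max_top_iff by blast
    \<comment> \<open>Joining with the radical does not change \<open>gmap\<close>, and it makes the
      meet of the two congruences exactly \<open>Rad S A\<close>.\<close>
    define \<gamma> where "\<gamma> = cjoin S A \<gamma>0 (Rad S A)"
    define \<delta> where "\<delta> = cjoin S A \<delta>0 (Rad S A)"
    have C: "\<gamma> \<in> Con S A" "\<delta> \<in> Con S A" unfolding \<gamma>_def \<delta>_def by (rule cjoin_in_Con[OF algebra_A])+
    have U: "U = gmap S A \<gamma>" "Max S A - U = gmap S A \<delta>"
      using UV gmap_cjoin[OF _ Rad_in_Con] gmap_Rad by (auto simp: \<gamma>_def \<delta>_def)
    have ex: "\<gamma> \<subseteq> \<phi> \<longleftrightarrow> \<not> \<delta> \<subseteq> \<phi>" if "\<phi> \<in> Max S A" for \<phi>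
      using U that unfolding gmap_eq by blast
    have J: "cjoin S A \<gamma> \<delta> = Nabla A" using ex by (intro comaximalI[OF C]) blast
    have "\<gamma> \<inter> \<delta> \<subseteq> Rad S A" using ex by (intro le_RadI Con_Int[OF algebra_A C]) blast
    moreover have "Rad S A \<subseteq> \<gamma> \<inter> \<delta>"
      using cjoin_upper(2)[OF _ Rad_in_Con] UV(1,2) unfolding \<gamma>_def \<delta>_def by blast
    ultimately have "\<gamma> \<inter> \<delta> = Rad S A" by blast
    then have "quot_cong (Rad S A) \<gamma> \<in> BoolCon S (quot_alg A (Rad S A))"
      using BoolCon_quot_iff[OF algebra_A Rad_in_Con] C J by blast
    then obtain \<alpha> where \<alpha>: "\<alpha> \<in> BoolCon S A"
      "quot_cong (Rad S A) (cjoin S A \<alpha> (Rad S A)) = quot_cong (Rad S A) \<gamma>"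
      using assms unfolding CBLP_def by blast
    note up = cjoin_upper(2)[OF BC[OF \<alpha>(1)] Rad_in_Con]
    have "cjoin S A \<alpha> (Rad S A) = \<gamma>"
      using lift_quot_cong[OF algebra_A Rad_in_Con cjoin_in_Con[OF algebra_A] up]
        lift_quot_cong[OF algebra_A Rad_in_Con C(1)] \<alpha>(2) \<open>Rad S A \<subseteq> \<gamma> \<inter> \<delta>\<close> by simp
    then have "U = gmap S A \<alpha>"
      using U(1) gmap_cjoin[OF BC[OF \<alpha>(1)] Rad_in_Con] gmap_Rad by simp
    then show "U \<in> gmap S A ` BoolCon S A" using \<alpha>(1) by blast
  qed
qed

text \<open>Complements \<gamma>, \<delta> modulo the radical give a clopen set, which is the image
  of some \<alpha> in \<open>BoolCon S A\<close>. The equality of \<gamma> with the join of \<alpha>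
  and \<open>Rad S A\<close> follows from \<open>le_if_gmap_le\<close> in one direction and
  \<open>comaximal_distrib\<close> in the other.\<close>

lemma bool_iso_imp_CBLP:
  assumes "bool_iso S A (gmap S A)"
  shows "CBLP S A (Rad S A)"
  unfolding CBLP_def
proof
  fix \<beta> assume "\<beta> \<in> BoolCon S (quot_alg A (Rad S A))"
  then obtain \<gamma> \<delta> where c: "\<gamma> \<in> Con S A" "\<delta> \<in> Con S A" "cjoin S A \<gamma> \<delta> = Nabla A"
    "\<gamma> \<inter> \<delta> = Rad S A" "\<beta> = quot_cong (Rad S A) \<gamma>"
    using BoolCon_quot_iff[OF algebra_A Rad_in_Con] by blast
  have comp: "Max S A - gmap S A \<gamma> = gmap S A \<delta>"
    using c Rad_le_Max by (intro gmap_complement) auto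
  then have "gmap S A \<gamma> \<in> Clop (max_top S A)" unfolding Clop_max_top_iff using c by blast
  moreover have "gmap S A ` BoolCon S A = Clop (max_top S A)"
    using assms by (simp add: bool_iso_def bij_betw_def)
  ultimately have "gmap S A \<gamma> \<in> gmap S A ` BoolCon S A" by simp
  then obtain \<alpha> where \<alpha>: "\<alpha> \<in> BoolCon S A" "gmap S A \<alpha> = gmap S A \<gamma>" by (elim imageE) simp
  obtain \<alpha>' where \<alpha>': "\<alpha> \<in> Con S A" "\<alpha>' \<in> Con S A" "cjoin S A \<alpha> \<alpha>' = Nabla A"
    "Max S A - gmap S A \<alpha> = gmap S A \<alpha>'"
    using BoolConD[OF \<alpha>(1)] by metis
  have "\<alpha> \<subseteq> \<gamma>" using le_if_gmap_le[OF \<alpha>(1) c(1)] \<alpha>(2) by blast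
  moreover have "\<gamma> \<subseteq> cjoin S A \<alpha> (Rad S A)"
  proof (rule comaximal_distrib[OF \<alpha>'(2,1) c(1) cjoin_in_Con[OF algebra_A]])
    show "cjoin S A \<alpha>' \<alpha> = Nabla A" using \<alpha>'(3) cjoin_commute by metis
    \<comment> \<open>A maximal congruence not above \<gamma> is not above \<alpha> either, as the
      two have the same image, so it lies above the complement of \<alpha>.\<close>
    have "\<alpha>' \<inter> \<gamma> \<subseteq> Rad S A"
    proof (rule le_RadI[OF Con_Int[OF algebra_A \<alpha>'(2) c(1)]])
      fix \<phi> assume "\<phi> \<in> Max S A"
      then have "\<gamma> \<subseteq> \<phi> \<or> \<alpha>' \<subseteq> \<phi>" using \<alpha>(2) \<alpha>'(4) unfolding gmap_eq by blast
      then show "\<alpha>' \<inter> \<gamma> \<subseteq> \<phi>" by blast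
    qed
    then show "\<alpha>' \<inter> \<gamma> \<subseteq> cjoin S A \<alpha> (Rad S A)" using cjoin_upper(2)[OF \<alpha>'(1) Rad_in_Con] by blast
    show "\<alpha> \<subseteq> cjoin S A \<alpha> (Rad S A)" by (rule cjoin_upper(1)[OF \<alpha>'(1) Rad_in_Con])
  qed
  ultimately have "cjoin S A \<alpha> (Rad S A) = \<gamma>"
    using cjoin_least[OF c(1), of \<alpha> "Rad S A"] c(4) by blast
  then show "\<exists>\<alpha>\<in>BoolCon S A. quot_cong (Rad S A) (cjoin S A \<alpha> (Rad S A)) = \<beta>"
    using \<alpha>(1) c(5) by blast
qed

end

theorem theorem5p17:
  fixes S :: "'f sig" and Eqs :: "('f trm \<times> 'f trm) set" and A :: "('f, 'a) alg"
  assumes finite_sig: "finite (syms S)"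
    and wf_eqs: "\<forall>e\<in>Eqs. wf_trm S (fst e) \<and> wf_trm S (snd e)"
    and big_type: "infinite (UNIV :: 'a set)"
    and cong_modular: "\<forall>B :: ('f, 'a) alg. inV S Eqs B \<longrightarrow> modular_Con S B"
    and semidegenerate: "\<forall>B :: ('f, 'a) alg. inV S Eqs B \<and> nontrivial_alg B \<longrightarrow> \<not> has_one_elem_subalg S B"
    and K_closed: "\<forall>B :: ('f, 'a) alg. inV S Eqs B \<longrightarrow> K_comm_closed S B"
    and ret_bool: "\<forall>B :: ('f, 'a) alg. inV S Eqs B \<longrightarrow> ret_preserves_bool S B"
    and A_in_V: "inV S Eqs A"
  shows "CBLP S A (Rad S A) \<longleftrightarrow> bool_iso S A (gmap S A)"
proof -
  interpret modular_semidegenerate S Eqs A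
    using assms by unfold_locales
  show ?thesis using CBLP_imp_bool_iso bool_iso_imp_CBLP by blast
qed

end
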